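(* Let $f\in\mathfrak{F}$ be a function for which there is a constant $n_0$ with $f(x)+f(y)\le f(x+y)$ for all $x,y\ge n_0$. If $G_1,G_2\in\mathcal{B}_f$, then the free product $G_1\star G_2\in\mathcal{B}_f$.
   Context: $\mathfrak{F}$ is the set of nondecreasing functions from some interval $[Q,\infty)\cap\mathbb{N}$ to the nonnegative reals; $g\preceq f$ means there exist $N\ge0$ and positive integers $K,M$ with $g(n)\le Kf(Mn)$ for all $n\ge N$. For a group $G$ with finite generating set $A$, $S=A\cup A^{-1}$, $\pi:S^*\to G$ the evaluation map and $d_A$ the word metric: a Cayley automatic representation is a bijection $\psi:L\to G$ from a regular $L\subseteq S^*$ such that for each $a\in A$ the relation $\{(\psi^{-1}(g),\psi^{-1}(ga)) : g\in G\}$ is FA-recognizable (i.e., the language of convolutions — parallel readings of the two strings with the shorter padded by a new symbol — is regular). Its function is $h(n)=\max\{d_A(\pi(w),\psi(w)): w\in L,|w|\le n\}$, and $G\in\mathcal{B}_f$ means some Cayley automatic representation (for some finite generating set; this is independent of the choice) has $h\preceq f$. *)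

theory Defs
  imports "HOL-Algebra.Algebra"
begin

text \<open>Functions in F are represented as total functions nat => real; only values from
  some threshold Q on matter.\<close>
definition in_frakF :: "(nat \<Rightarrow> real) \<Rightarrow> bool" where
  "in_frakF f \<longleftrightarrow> (\<exists>Q. \<forall>n\<ge>Q. 0 \<le> f n \<and> (\<forall>m\<ge>n. f n \<le> f m))"

definition fun_preceq :: "(nat \<Rightarrow> real) \<Rightarrow> (nat \<Rightarrow> real) \<Rightarrow> bool" where
  "fun_preceq g f \<longleftrightarrow> (\<exists>(N::nat) (K::nat) (M::nat). K > 0 \<and> M > 0 \<and>
      (\<forall>n\<ge>N. g n \<le> real K * f (M * n)))"

definition regular_lang :: "'s set \<Rightarrow> 's list set \<Rightarrow> bool" where
  "regular_lang \<Sigma> L \<longleftrightarrow> finite \<Sigma> \<and>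
     (\<exists>(Q::nat set) (q0::nat) (F::nat set) (\<delta>::nat \<Rightarrow> 's \<Rightarrow> nat).
        finite Q \<and> q0 \<in> Q \<and> F \<subseteq> Q \<and> (\<forall>q\<in>Q. \<forall>s\<in>\<Sigma>. \<delta> q s \<in> Q) \<and>
        L = {w \<in> lists \<Sigma>. foldl \<delta> q0 w \<in> F})"

fun conv :: "'s list \<Rightarrow> 's list \<Rightarrow> ('s option \<times> 's option) list" where
  "conv [] [] = []"
| "conv (x # xs) [] = (Some x, None) # conv xs []"
| "conv [] (y # ys) = (None, Some y) # conv [] ys"
| "conv (x # xs) (y # ys) = (Some x, Some y) # conv xs ys"

definition pad_alph :: "'s set \<Rightarrow> ('s option \<times> 's option) set" where
  "pad_alph \<Sigma> = insert None (Some ` \<Sigma>) \<times> insert None (Some ` \<Sigma>)"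

definition fa_recognizable :: "'s set \<Rightarrow> ('s list \<times> 's list) set \<Rightarrow> bool" where
  "fa_recognizable \<Sigma> R \<longleftrightarrow> regular_lang (pad_alph \<Sigma>) ((\<lambda>(u, v). conv u v) ` R)"

definition sym_gens :: "('a, 'm) monoid_scheme \<Rightarrow> 'a set \<Rightarrow> 'a set" where
  "sym_gens G A = A \<union> (\<lambda>x. inv\<^bsub>G\<^esub> x) ` A"

definition eval_word :: "('a, 'm) monoid_scheme \<Rightarrow> 'a list \<Rightarrow> 'a" where
  "eval_word G w = foldr (\<lambda>x y. x \<otimes>\<^bsub>G\<^esub> y) w \<one>\<^bsub>G\<^esub>"

definition word_metric :: "('a, 'm) monoid_scheme \<Rightarrow> 'a set \<Rightarrow> 'a \<Rightarrow> 'a \<Rightarrow> nat" where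
  "word_metric G A g h = (LEAST n. \<exists>w\<in>lists (sym_gens G A). length w = n \<and>
       eval_word G w = inv\<^bsub>G\<^esub> g \<otimes>\<^bsub>G\<^esub> h)"

definition cayley_aut_rep ::
  "('a, 'm) monoid_scheme \<Rightarrow> 'a set \<Rightarrow> 'a list set \<Rightarrow> ('a list \<Rightarrow> 'a) \<Rightarrow> bool" where
  "cayley_aut_rep G A L \<psi> \<longleftrightarrow>
     regular_lang (sym_gens G A) L \<and> L \<subseteq> lists (sym_gens G A) \<and>
     bij_betw \<psi> L (carrier G) \<and>
     (\<forall>a\<in>A. fa_recognizable (sym_gens G A)
                {(u, v). u \<in> L \<and> v \<in> L \<and> \<psi> v = \<psi> u \<otimes>\<^bsub>G\<^esub> a})"

definition rep_fun ::
  "('a, 'm) monoid_scheme \<Rightarrow> 'a set \<Rightarrow> 'a list set \<Rightarrow> ('a list \<Rightarrow> 'a) \<Rightarrow> nat \<Rightarrow> real" where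
  "rep_fun G A L \<psi> n =
     (let D = {word_metric G A (eval_word G w) (\<psi> w) | w. w \<in> L \<and> length w \<le> n}
      in if D = {} then 0 else real (Max D))"

definition in_B :: "(nat \<Rightarrow> real) \<Rightarrow> ('a, 'm) monoid_scheme \<Rightarrow> bool" where
  "in_B f G \<longleftrightarrow> (\<exists>A L \<psi>. finite A \<and> A \<subseteq> carrier G \<and> generate G A = carrier G \<and>
       cayley_aut_rep G A L \<psi> \<and> fun_preceq (rep_fun G A L \<psi>) f)"

definition reduced_word ::
  "('a, 'm) monoid_scheme \<Rightarrow> ('b, 'n) monoid_scheme \<Rightarrow> ('a + 'b) list \<Rightarrow> bool" where
  "reduced_word G H w \<longleftrightarrow>
     (\<forall>x\<in>set w. case x of Inl a \<Rightarrow> a \<in> carrier G - {\<one>\<^bsub>G\<^esub>}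
                        | Inr b \<Rightarrow> b \<in> carrier H - {\<one>\<^bsub>H\<^esub>}) \<and>
     (\<forall>i. Suc i < length w \<longrightarrow> isl (w ! i) \<noteq> isl (w ! Suc i))"

fun push ::
  "('a, 'm) monoid_scheme \<Rightarrow> ('b, 'n) monoid_scheme \<Rightarrow> 'a + 'b \<Rightarrow> ('a + 'b) list \<Rightarrow> ('a + 'b) list" where
  "push G H (Inl a) [] = (if a = \<one>\<^bsub>G\<^esub> then [] else [Inl a])"
| "push G H (Inr b) [] = (if b = \<one>\<^bsub>H\<^esub> then [] else [Inr b])"
| "push G H (Inl a) (Inl a' # w) =
     (let c = a \<otimes>\<^bsub>G\<^esub> a' in if c = \<one>\<^bsub>G\<^esub> then w else Inl c # w)"
| "push G H (Inr b) (Inr b' # w) =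
     (let c = b \<otimes>\<^bsub>H\<^esub> b' in if c = \<one>\<^bsub>H\<^esub> then w else Inr c # w)"
| "push G H (Inl a) (Inr b' # w) = (if a = \<one>\<^bsub>G\<^esub> then Inr b' # w else Inl a # Inr b' # w)"
| "push G H (Inr b) (Inl a' # w) = (if b = \<one>\<^bsub>H\<^esub> then Inl a' # w else Inr b # Inl a' # w)"

definition free_product ::
  "('a, 'm) monoid_scheme \<Rightarrow> ('b, 'n) monoid_scheme \<Rightarrow> ('a + 'b) list monoid" where
  "free_product G H =
     \<lparr>carrier = {w. reduced_word G H w},
      monoid.mult = (\<lambda>u v. foldr (push G H) u v),
      one = []\<rparr>"

end

theory Submission
  imports Defs
begin

text \<open>
  A language is regular iff it has finitely many left quotients, which makes closure under union,
  difference, concatenation, star and letter maps a matter of counting.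

  Write an element of the free product as the concatenation of blocks, one for each syllable \<open>g\<close>: the
  letters \<open>a a\<^sup>-\<^sup>1\<close> followed by the representative of \<open>g\<close>, where \<open>a\<close> is a nonidentity generator of the
  factor of \<open>g\<close>. Sides alternate and every block starts with a nonidentity letter, so a word
  determines its blocks. Right multiplication by a generator of one factor changes at most the final
  block, so each multiplication relation is the concatenation of a diagonal and a relation obtained
  from that factor.

  If \<open>f\<close> vanishes eventually, evaluation and representation agree in both factors, hence in the
  free product. Otherwise superadditivity makes \<open>f\<close> grow at least linearly; the distance is bounded
  by the word length plus the sum of the lengths of the syllables, and superadditivity bounds the
  sum of the values of \<open>f\<close> over the blocks by the value of \<open>f\<close> at a multiple of the word length.
\<close>

section \<open>Regular languages via left quotients\<close>

text \<open>The Myhill-Nerode condition. The prefix \<open>u\<close> ranges over all words of the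
  type, so no alphabet has to be carried through the closure properties.\<close>

definition fin_deriv :: "'s list set \<Rightarrow> bool" where
  "fin_deriv L \<longleftrightarrow> finite (range (\<lambda>u. {w. u @ w \<in> L}))"

definition lconc :: "'s list set \<Rightarrow> 's list set \<Rightarrow> 's list set" where
  "lconc L M = {u @ v | u v. u \<in> L \<and> v \<in> M}"

definition lstar :: "'s list set \<Rightarrow> 's list set" where
  "lstar L = concat ` lists L"

lemma fin_derivI:
  assumes "finite S" "\<And>u. {w. u @ w \<in> L} \<in> S"
  shows "fin_deriv L"
  unfolding fin_deriv_def using assms by (meson finite_subset image_subsetI)

text \<open>The quotient by a word over the alphabet depends only on the state that the word
  reaches. Any other word has the empty quotient, hence the extra \<open>{}\<close>.\<close>

lemma regular_lang_imp_fin_deriv: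
  assumes "regular_lang \<Sigma> L"
  shows "fin_deriv L"
proof -
  from assms obtain Q q0 F \<delta> where Q: "finite (Q::nat set)" "q0 \<in> Q"
    and \<delta>: "\<forall>q\<in>Q. \<forall>s\<in>\<Sigma>. \<delta> q s \<in> Q"
    and L: "L = {w \<in> lists \<Sigma>. foldl \<delta> q0 w \<in> F}"
    unfolding regular_lang_def by blast
  have run: "foldl \<delta> q u \<in> Q" if "q \<in> Q" "u \<in> lists \<Sigma>" for q u
    using that by (induction u arbitrary: q) (use \<delta> in auto)
  have "{w. u @ w \<in> L} \<in> insert {} ((\<lambda>q. {w \<in> lists \<Sigma>. foldl \<delta> q w \<in> F}) ` Q)" for u
  proof (cases "u \<in> lists \<Sigma>")
    case True
    then have "{w. u @ w \<in> L} = {w \<in> lists \<Sigma>. foldl \<delta> (foldl \<delta> q0 u) w \<in> F}"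
      by (auto simp: L)
    then show ?thesis using run[OF Q(2) True] by blast
  next
    case False
    then show ?thesis by (auto simp: L)
  qed
  then show ?thesis by (rule fin_derivI[rotated]) (simp add: Q(1))
qed

text \<open>The quotients themselves serve as states of an automaton. As \<open>regular_lang\<close>
  asks for states in \<open>nat\<close>, they are numbered by an injection \<open>enc\<close>, and a
  transition decodes, takes the quotient by one letter and encodes again.\<close>

lemma fin_deriv_imp_regular_lang:
  assumes "finite \<Sigma>" and sub: "L \<subseteq> lists \<Sigma>" and "fin_deriv L"
  shows "regular_lang \<Sigma> L"
proof -
  define D where "D = range (\<lambda>u. {w. u @ w \<in> L})"
  have finD: "finite D" using assms(3) by (simp add: fin_deriv_def D_def)
  then obtain enc :: "'a list set \<Rightarrow> nat" where enc: "inj_on enc D"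
    using finite_imp_inj_to_nat_seg by blast
  define \<delta> where "\<delta> q s = enc {w. s # w \<in> inv_into D enc q}" for q s
  have LD: "L \<in> D" unfolding D_def by (rule range_eqI[of _ _ "[]"]) simp
  have D_closed: "{w. u @ w \<in> Z} \<in> D" if "Z \<in> D" for Z u
    using that by (force simp: D_def simp flip: append_assoc)
  have step: "\<delta> (enc Z) s = enc {w. s # w \<in> Z}" if "Z \<in> D" for Z s
    using that enc by (simp add: \<delta>_def)
  have run: "foldl \<delta> (enc Z) w = enc {v. w @ v \<in> Z}" if "Z \<in> D" for Z w
    using that
  proof (induction w arbitrary: Z)
    case (Cons s w)
    then show ?case using D_closed[of Z "[s]"] by (simp add: step)
  qed simp
  \<comment> \<open>A word belongs to \<open>L\<close> iff its quotient contains the empty word.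
    Injectivity of \<open>enc\<close> on \<open>D\<close> carries this criterion over to the
    codes.\<close>
  have accept: "foldl \<delta> (enc L) w \<in> enc ` {Z \<in> D. [] \<in> Z} \<longleftrightarrow> w \<in> L" for w
  proof -
    have "{v. w @ v \<in> L} \<in> D" using D_closed[OF LD] .
    then have "enc {v. w @ v \<in> L} \<in> enc ` {Z \<in> D. [] \<in> Z} \<longleftrightarrow> {v. w @ v \<in> L} \<in> {Z \<in> D. [] \<in> Z}"
      using enc by (intro inj_on_image_mem_iff[of enc D]) auto
    then show ?thesis using \<open>{v. w @ v \<in> L} \<in> D\<close> by (simp add: run[OF LD])
  qed
  have \<delta>_closed: "\<delta> q s \<in> enc ` D" if "q \<in> enc ` D" for q s
    using that D_closed[of _ "[s]"] by (auto simp: step)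
  show ?thesis
    unfolding regular_lang_def
  proof (intro conjI exI)
    show "finite (enc ` D)" using finD by simp
    show "enc L \<in> enc ` D" using LD by simp
    show "enc ` {Z \<in> D. [] \<in> Z} \<subseteq> enc ` D" by blast
    show "\<forall>q\<in>enc ` D. \<forall>s\<in>\<Sigma>. \<delta> q s \<in> enc ` D" using \<delta>_closed by blast
    show "L = {w \<in> lists \<Sigma>. foldl \<delta> (enc L) w \<in> enc ` {Z \<in> D. [] \<in> Z}}"
      using sub by (auto simp only: accept)
  qed (use assms(1) in simp)
qed

text \<open>Quotients commute with Boolean operations, so each quotient of the union comes from a
  pair of quotients.\<close>

lemma fin_deriv_Un:
  assumes "fin_deriv L" "fin_deriv M"
  shows "fin_deriv (L \<union> M)"
proof (rule fin_derivI)
  let ?D = "\<lambda>L. range (\<lambda>u. {w. u @ w \<in> L})"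
  show "finite ((\<lambda>(Z, Y). Z \<union> Y) ` (?D L \<times> ?D M))"
    using assms unfolding fin_deriv_def by blast
  show "{w. u @ w \<in> L \<union> M} \<in> (\<lambda>(Z, Y). Z \<union> Y) ` (?D L \<times> ?D M)" for u
    by (intro image_eqI[of _ _ "({w. u @ w \<in> L}, {w. u @ w \<in> M})"]) auto
qed

lemma fin_deriv_Diff:
  assumes "fin_deriv L" "fin_deriv M"
  shows "fin_deriv (L - M)"
proof (rule fin_derivI)
  let ?D = "\<lambda>L. range (\<lambda>u. {w. u @ w \<in> L})"
  show "finite ((\<lambda>(Z, Y). Z - Y) ` (?D L \<times> ?D M))"
    using assms unfolding fin_deriv_def by blast
  show "{w. u @ w \<in> L - M} \<in> (\<lambda>(Z, Y). Z - Y) ` (?D L \<times> ?D M)" for u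
    by (intro image_eqI[of _ _ "({w. u @ w \<in> L}, {w. u @ w \<in> M})"]) auto
qed

text \<open>Every quotient is a set of suffixes of members of \<open>L\<close>, and there are only
  finitely many such suffixes.\<close>

lemma fin_deriv_finite:
  assumes "finite L"
  shows "fin_deriv L"
proof -
  have "range (\<lambda>u. {w. u @ w \<in> L}) \<subseteq> Pow (\<Union>v\<in>L. (\<lambda>n. drop n v) ` {..length v})"
  proof clarsimp
    fix u w assume "u @ w \<in> L"
    then show "\<exists>v\<in>L. w \<in> (\<lambda>n. drop n v) ` {..length v}"
      by (intro bexI[of _ "u @ w"] image_eqI[of _ _ "length u"]) auto
  qed
  moreover have "finite (Pow (\<Union>v\<in>L. (\<lambda>n. drop n v) ` {..length v}))"
    using assms by simp
  ultimately show ?thesis unfolding fin_deriv_def by (rule finite_subset)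
qed

text \<open>The boundary between the two factors falls either after \<open>u\<close> or inside it.
  So the quotient by \<open>u\<close> is a quotient of \<open>L\<close> followed by
  \<open>M\<close>, together with the quotients of \<open>M\<close> by what remains of
  \<open>u\<close> after a prefix in \<open>L\<close>. The latter form a subset of a finite
  set.\<close>

lemma fin_deriv_lconc:
  assumes "fin_deriv L" "fin_deriv M"
  shows "fin_deriv (lconc L M)"
proof -
  let ?D = "\<lambda>L. range (\<lambda>u. {w. u @ w \<in> L})"
  have "{w. u @ w \<in> lconc L M} \<in> (\<lambda>(Z, Y). lconc Z M \<union> \<Union>Y) ` (?D L \<times> Pow (?D M))" for u
  proof -
    let ?Y = "{{w. u2 @ w \<in> M} | u1 u2. u = u1 @ u2 \<and> u1 \<in> L}"
    have "w \<in> lconc {w. u @ w \<in> L} M \<union> \<Union>?Y" if "u @ w \<in> lconc L M" for w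
    proof -
      from that obtain x y where xy: "u @ w = x @ y" "x \<in> L" "y \<in> M"
        by (auto simp: lconc_def)
      from xy(1) consider t where "u @ t = x" "w = t @ y" | t where "u = x @ t" "t @ w = y"
        by (auto simp: append_eq_append_conv2)
      then show ?thesis
      proof cases
        case 1
        then show ?thesis using xy by (auto simp: lconc_def)
      next
        case 2
        then have "{w. t @ w \<in> M} \<in> ?Y" "w \<in> {w. t @ w \<in> M}" using xy by auto
        then show ?thesis by blast
      qed
    qed
    moreover have "u @ w \<in> lconc L M" if "w \<in> lconc {w. u @ w \<in> L} M \<union> \<Union>?Y" for w
    proof -
      from that consider "w \<in> lconc {w. u @ w \<in> L} M"
        | u1 u2 where "u = u1 @ u2" "u1 \<in> L" "u2 @ w \<in> M" by blast
      then show ?thesis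
      proof cases
        case 1
        then obtain x y where "w = x @ y" "u @ x \<in> L" "y \<in> M" by (auto simp: lconc_def)
        then have "u @ w = (u @ x) @ y" "u @ x \<in> L" "y \<in> M" by auto
        then show ?thesis unfolding lconc_def by blast
      next
        case 2
        then have "u @ w = u1 @ (u2 @ w)" by simp
        with 2 show ?thesis unfolding lconc_def by blast
      qed
    qed
    ultimately have "{w. u @ w \<in> lconc L M} = lconc {w. u @ w \<in> L} M \<union> \<Union>?Y"
      by blast
    moreover have "?Y \<in> Pow (?D M)" by auto
    ultimately show ?thesis by (intro image_eqI[of _ _ "({w. u @ w \<in> L}, ?Y)"]) auto
  qed
  moreover have "finite ((\<lambda>(Z, Y). lconc Z M \<union> \<Union>Y) ` (?D L \<times> Pow (?D M)))"
    using assms by (simp add: fin_deriv_def)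
  ultimately show ?thesis by (intro fin_derivI)
qed

text \<open>The cut after \<open>u\<close> is located within one factor of the concatenation. A cut
  at a boundary counts as lying at the end of the earlier factor, which exists because
  \<open>u\<close> is nonempty.\<close>

lemma append_eq_concat_split:
  assumes "u @ w = concat ws" "u \<noteq> []"
  shows "\<exists>us a b vs. ws = us @ (a @ b) # vs \<and> u = concat us @ a \<and> w = b @ concat vs"
  using assms
proof (induction ws arbitrary: u)
  case (Cons x ws)
  from Cons.prems(1) consider t where "u @ t = x" "w = t @ concat ws"
    | t where "u = x @ t" "t @ w = concat ws"
    by (auto simp: append_eq_append_conv2)
  then show ?case
  proof cases
    case 1
    then have "x # ws = [] @ (u @ t) # ws \<and> u = concat [] @ u \<and> w = t @ concat ws"
      by auto
    then show ?thesis by blast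
  next
    case 2
    show ?thesis
    proof (cases "t = []")
      case True
      with 2 have "x # ws = [] @ (x @ []) # ws \<and> u = concat [] @ x \<and> w = [] @ concat ws"
        by auto
      then show ?thesis by blast
    next
      case False
      from Cons.IH[OF 2(2) False] obtain us a b vs
        where "ws = us @ (a @ b) # vs \<and> t = concat us @ a \<and> w = b @ concat vs" by blast
      with 2 have "x # ws = (x # us) @ (a @ b) # vs \<and> u = concat (x # us) @ a \<and> w = b @ concat vs"
        by auto
      then show ?thesis by blast
    qed
  qed
qed simp

text \<open>For nonempty \<open>u\<close>, the factor in which \<open>u\<close> ends contributes a
  quotient of \<open>L\<close>, and the remaining factors contribute the star. Hence every quotient
  is determined by a set of quotients of \<open>L\<close>, except that of \<open>[]\<close>, which
  is the star itself.\<close>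

lemma fin_deriv_lstar:
  assumes "fin_deriv L"
  shows "fin_deriv (lstar L)"
proof -
  let ?D = "\<lambda>L. range (\<lambda>u. {w. u @ w \<in> L})"
  have "{w. u @ w \<in> lstar L} \<in> insert (lstar L) ((\<lambda>Y. \<Union>Z\<in>Y. lconc Z (lstar L)) ` Pow (?D L))" for u
  proof (cases "u = []")
    case False
    let ?Y = "{{w. a @ w \<in> L} | us a. u = concat us @ a \<and> us \<in> lists L}"
    have "w \<in> (\<Union>Z\<in>?Y. lconc Z (lstar L))" if w: "u @ w \<in> lstar L" for w
    proof -
      obtain ws where ws: "ws \<in> lists L" "u @ w = concat ws"
        using w by (auto simp: lstar_def)
      from append_eq_concat_split[OF ws(2) False] obtain us a b vs
        where *: "ws = us @ (a @ b) # vs" "u = concat us @ a" "w = b @ concat vs" by blast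
      have "w \<in> lconc {w. a @ w \<in> L} (lstar L)" "us \<in> lists L"
        using * ws(1) by (auto simp: lconc_def lstar_def)
      then show ?thesis using *(2) by blast
    qed
    moreover have "u @ w \<in> lstar L" if w: "w \<in> (\<Union>Z\<in>?Y. lconc Z (lstar L))" for w
    proof -
      from w obtain us a b vs where "u = concat us @ a" "us \<in> lists L" "a @ b \<in> L"
        "vs \<in> lists L" "w = b @ concat vs"
        by (auto simp: lconc_def lstar_def)
      then show ?thesis
        unfolding lstar_def by (intro image_eqI[of _ _ "us @ (a @ b) # vs"]) auto
    qed
    ultimately have "{w. u @ w \<in> lstar L} = (\<Union>Z\<in>?Y. lconc Z (lstar L))" by blast
    moreover have "?Y \<in> Pow (?D L)" by auto
    ultimately show ?thesis by blast
  qed simp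
  moreover have "finite (insert (lstar L) ((\<lambda>Y. \<Union>Z\<in>Y. lconc Z (lstar L)) ` Pow (?D L)))"
    using assms by (simp add: fin_deriv_def)
  ultimately show ?thesis by (intro fin_derivI)
qed

text \<open>As \<open>h\<close> may identify letters, \<open>u\<close> can have many preimages. The
  quotient by \<open>u\<close> is the image of the union of the quotients by all of them, and only
  the set of those quotients matters.\<close>

lemma fin_deriv_map:
  assumes "fin_deriv L"
  shows "fin_deriv (map h ` L)"
proof -
  let ?D = "\<lambda>L. range (\<lambda>u. {w. u @ w \<in> L})"
  have "{w. u @ w \<in> map h ` L} \<in> (\<lambda>Y. \<Union>Z\<in>Y. map h ` Z) ` Pow (?D L)" for u
  proof -
    let ?Y = "{{w. v @ w \<in> L} | v. map h v = u}"
    have "w \<in> (\<Union>Z\<in>?Y. map h ` Z)" if w: "u @ w \<in> map h ` L" for w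
    proof -
      obtain x where "x \<in> L" "map h x = u @ w" using w by (metis imageE)
      then show ?thesis by (auto simp: map_eq_append_conv)
    qed
    moreover have "u @ w \<in> map h ` L" if "w \<in> (\<Union>Z\<in>?Y. map h ` Z)" for w
      using that by (auto simp flip: map_append)
    ultimately have "{w. u @ w \<in> map h ` L} = (\<Union>Z\<in>?Y. map h ` Z)" by blast
    moreover have "?Y \<in> Pow (?D L)" by auto
    ultimately show ?thesis by blast
  qed
  moreover have "finite ((\<lambda>Y. \<Union>Z\<in>Y. map h ` Z) ` Pow (?D L))"
    using assms by (simp add: fin_deriv_def)
  ultimately show ?thesis by (intro fin_derivI)
qed

section \<open>Convolutions of words\<close>

lemma conv_append: "conv (x @ u) (x @ v) = conv x x @ conv u v"
  by (induction x) auto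

lemma conv_diag: "conv x x = map (\<lambda>s. (Some s, Some s)) x"
  by (induction x) auto

lemma conv_map:
  "conv (map e u) (map e v) = map (map_prod (map_option e) (map_option e)) (conv u v)"
  by (induction u v rule: conv.induct) auto

text \<open>Deleting the padding recovers both words, so a convolution determines its pair. This
  makes it possible to remove single pairs from a relation by removing their convolutions.\<close>

lemma map_the_filter_conv:
  "map (the \<circ> fst) (filter (\<lambda>p. fst p \<noteq> None) (conv u v)) = u"
  "map (the \<circ> snd) (filter (\<lambda>p. snd p \<noteq> None) (conv u v)) = v"
  by (induction u v rule: conv.induct) auto

lemma conv_in_lists_pad_alph:
  "u \<in> lists \<Sigma> \<Longrightarrow> v \<in> lists \<Sigma> \<Longrightarrow> conv u v \<in> lists (pad_alph \<Sigma>)"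
  by (induction u v rule: conv.induct) (auto simp: pad_alph_def)

lemma fa_recognizableI:
  assumes "finite \<Sigma>" "R \<subseteq> lists \<Sigma> \<times> lists \<Sigma>" "fin_deriv ((\<lambda>(u, v). conv u v) ` R)"
  shows "fa_recognizable \<Sigma> R"
  unfolding fa_recognizable_def
proof (rule fin_deriv_imp_regular_lang)
  show "finite (pad_alph \<Sigma>)" using assms(1) by (simp add: pad_alph_def)
  show "(\<lambda>(u, v). conv u v) ` R \<subseteq> lists (pad_alph \<Sigma>)"
  proof
    fix x assume "x \<in> (\<lambda>(u, v). conv u v) ` R"
    then obtain u v where "x = conv u v" "(u, v) \<in> R" by auto
    moreover from this have "u \<in> lists \<Sigma>" "v \<in> lists \<Sigma>" using assms(2) by blast+
    ultimately show "x \<in> lists (pad_alph \<Sigma>)" by (simp add: conv_in_lists_pad_alph)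
  qed
qed (rule assms(3))

section \<open>The group structure of the free product\<close>

locale two_groups = G: group G + H: group H
  for G :: "('a, 'm) monoid_scheme" and H :: "('b, 'n) monoid_scheme"
begin

definition in_syl :: "'a + 'b \<Rightarrow> bool" where
  "in_syl x \<longleftrightarrow> (case x of Inl a \<Rightarrow> a \<in> carrier G | Inr b \<Rightarrow> b \<in> carrier H)"

definition is_one :: "'a + 'b \<Rightarrow> bool" where
  "is_one x \<longleftrightarrow> (case x of Inl a \<Rightarrow> a = \<one>\<^bsub>G\<^esub> | Inr b \<Rightarrow> b = \<one>\<^bsub>H\<^esub>)"

text \<open>Only meaningful when both arguments lie on the same side of the sum.\<close>
definition smul :: "'a + 'b \<Rightarrow> 'a + 'b \<Rightarrow> 'a + 'b" where
  "smul x y = (case x of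
      Inl a \<Rightarrow> Inl (a \<otimes>\<^bsub>G\<^esub> (case y of Inl a' \<Rightarrow> a' | Inr b' \<Rightarrow> a))
    | Inr b \<Rightarrow> Inr (b \<otimes>\<^bsub>H\<^esub> (case y of Inl a' \<Rightarrow> b | Inr b' \<Rightarrow> b')))"

text \<open>The image of a factor element in the free product. Sending the identity to the empty
  word lets a syllable that cancels be treated like any other.\<close>

definition emb :: "'a + 'b \<Rightarrow> ('a + 'b) list" where
  "emb x = (if is_one x then [] else [x])"

abbreviation reduced :: "('a + 'b) list \<Rightarrow> bool" where
  "reduced \<equiv> reduced_word G H"

abbreviation P :: "('a + 'b) list monoid" where
  "P \<equiv> free_product G H"

lemmas syl_defs = in_syl_def is_one_def smul_def

lemma isl_smul [simp]: "isl (smul x y) = isl x"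
  by (cases x) (auto simp: smul_def)

lemma in_syl_smul: "in_syl x \<Longrightarrow> in_syl y \<Longrightarrow> isl x = isl y \<Longrightarrow> in_syl (smul x y)"
  by (cases x; cases y) (auto simp: syl_defs)

lemma smul_assoc:
  "in_syl x \<Longrightarrow> in_syl y \<Longrightarrow> in_syl z \<Longrightarrow> isl x = isl y \<Longrightarrow> isl y = isl z \<Longrightarrow>
    smul (smul x y) z = smul x (smul y z)"
  by (cases x; cases y; cases z) (auto simp: syl_defs G.m_assoc H.m_assoc)

lemma smul_one_left: "in_syl y \<Longrightarrow> isl x = isl y \<Longrightarrow> is_one x \<Longrightarrow> smul x y = y"
  by (cases x; cases y) (auto simp: syl_defs)

lemma smul_one_right: "in_syl x \<Longrightarrow> isl x = isl y \<Longrightarrow> is_one y \<Longrightarrow> smul x y = x"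
  by (cases x; cases y) (auto simp: syl_defs)

lemma one_exists: "\<exists>e. in_syl e \<and> is_one e \<and> isl e = s"
proof (cases s)
  case True
  then show ?thesis by (intro exI[of _ "Inl \<one>\<^bsub>G\<^esub>"]) (simp add: syl_defs)
next
  case False
  then show ?thesis by (intro exI[of _ "Inr \<one>\<^bsub>H\<^esub>"]) (simp add: syl_defs)
qed

lemma sinv_exists: "in_syl x \<Longrightarrow> \<exists>y. in_syl y \<and> isl y = isl x \<and> is_one (smul y x)"
proof (cases x)
  case (Inl a)
  assume "in_syl x"
  with Inl show ?thesis by (intro exI[of _ "Inl (inv\<^bsub>G\<^esub> a)"]) (simp add: syl_defs)
next
  case (Inr b)
  assume "in_syl x"
  with Inr show ?thesis by (intro exI[of _ "Inr (inv\<^bsub>H\<^esub> b)"]) (simp add: syl_defs)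
qed

section \<open>Reduced words and the action of syllables on them\<close>

lemma reduced_Nil [simp]: "reduced []"
  by (simp add: reduced_word_def)

text \<open>Replaces the alternation condition on indices by a recursive one: index \<open>0\<close>
  compares \<open>x\<close> with the head of \<open>w\<close>, and the later indices concern
  \<open>w\<close> alone.\<close>

lemma reduced_Cons:
  "reduced (x # w) \<longleftrightarrow> in_syl x \<and> \<not> is_one x \<and> reduced w \<and> (w = [] \<or> isl x \<noteq> isl (hd w))"
proof -
  have "(\<forall>i. Suc i < length (x # w) \<longrightarrow> isl ((x # w) ! i) \<noteq> isl ((x # w) ! Suc i)) \<longleftrightarrow>
        (w = [] \<or> isl x \<noteq> isl (hd w)) \<and>
        (\<forall>i. Suc i < length w \<longrightarrow> isl (w ! i) \<noteq> isl (w ! Suc i))" (is "?l \<longleftrightarrow> ?r")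
  proof
    assume l: ?l
    have "w = [] \<or> isl x \<noteq> isl (hd w)" using l[rule_format, of 0] by (cases w) auto
    moreover have "isl (w ! i) \<noteq> isl (w ! Suc i)" if "Suc i < length w" for i
      using l[rule_format, of "Suc i"] that by simp
    ultimately show ?r by blast
  next
    assume r: ?r
    show ?l
    proof (intro allI impI)
      fix i assume i: "Suc i < length (x # w)"
      show "isl ((x # w) ! i) \<noteq> isl ((x # w) ! Suc i)"
      proof (cases i)
        case 0
        then show ?thesis using conjunct1[OF r] i by (cases w) auto
      next
        case (Suc j)
        then show ?thesis using conjunct2[OF r, rule_format, of j] i by simp
      qed
    qed
  qed
  moreover have "(\<forall>y\<in>set (x # w). case y of Inl a \<Rightarrow> a \<in> carrier G - {\<one>\<^bsub>G\<^esub>}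
      | Inr b \<Rightarrow> b \<in> carrier H - {\<one>\<^bsub>H\<^esub>}) \<longleftrightarrow> in_syl x \<and> \<not> is_one x \<and>
    (\<forall>y\<in>set w. case y of Inl a \<Rightarrow> a \<in> carrier G - {\<one>\<^bsub>G\<^esub>} | Inr b \<Rightarrow> b \<in> carrier H - {\<one>\<^bsub>H\<^esub>})"
    by (cases x) (simp_all add: syl_defs)
  ultimately show ?thesis unfolding reduced_word_def by argo
qed

lemma reduced_append:
  "reduced (u @ v) \<longleftrightarrow> reduced u \<and> reduced v \<and> (u = [] \<or> v = [] \<or> isl (last u) \<noteq> isl (hd v))"
  by (induction u) (auto simp: reduced_Cons hd_append)

lemma reduced_in_syl: "reduced w \<Longrightarrow> x \<in> set w \<Longrightarrow> in_syl x \<and> \<not> is_one x"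
  by (induction w) (auto simp: reduced_Cons)

lemma reduced_emb: "in_syl x \<Longrightarrow> reduced (emb x)"
  by (auto simp: emb_def reduced_Cons)

lemma reduced_emb_append:
  "in_syl z \<Longrightarrow> reduced v \<Longrightarrow> v = [] \<or> isl (hd v) \<noteq> isl z \<Longrightarrow> reduced (emb z @ v)"
  by (auto simp: emb_def reduced_Cons)

lemma reduced_append_emb:
  "in_syl z \<Longrightarrow> reduced v \<Longrightarrow> v = [] \<or> isl (last v) \<noteq> isl z \<Longrightarrow> reduced (v @ emb z)"
  by (auto simp: emb_def reduced_append reduced_Cons)

text \<open>If the word does not start on side \<open>s\<close>, the identity of that side is split
  off. Thus one form covers every reduced word, whatever its first syllable.\<close>

lemma split_emb_left:
  assumes "reduced w"
  obtains z v where "in_syl z" "isl z = s" "w = emb z @ v" "reduced v" "v = [] \<or> isl (hd v) \<noteq> s"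
proof (cases "w \<noteq> [] \<and> isl (hd w) = s")
  case True
  then obtain z v where "w = z # v" by (cases w) auto
  with True assms show thesis by (intro that[of z v]) (auto simp: reduced_Cons emb_def)
next
  case False
  obtain e where "in_syl e" "is_one e" "isl e = s" using one_exists by blast
  with False assms show thesis by (intro that[of e w]) (auto simp: emb_def)
qed

lemma split_emb_right:
  assumes "reduced w"
  obtains z v where "in_syl z" "isl z = s" "w = v @ emb z" "reduced v" "v = [] \<or> isl (last v) \<noteq> s"
proof (cases "w \<noteq> [] \<and> isl (last w) = s")
  case True
  then obtain z v where "w = v @ [z]" by (cases w rule: rev_cases) auto
  with True assms show thesis
    by (intro that[of z v]) (auto simp: reduced_append reduced_Cons emb_def)
next
  case False
  obtain e where "in_syl e" "is_one e" "isl e = s" using one_exists by blast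
  with False assms show thesis by (intro that[of e w]) (auto simp: emb_def)
qed

text \<open>Summarises all defining equations of \<open>push\<close>: once a possibly trivial
  syllable on the side of \<open>x\<close> is split off, \<open>push\<close> is multiplication
  inside the factor. The proofs below use this form and need no case split on cancellation.\<close>

lemma push_emb_append:
  assumes "in_syl x" "in_syl z" "isl x = isl z" "v = [] \<or> isl (hd v) \<noteq> isl z"
  shows "push G H x (emb z @ v) = emb (smul x z) @ v"
proof (cases x)
  case (Inl a)
  with assms(3) obtain a' where "z = Inl a'" by (cases z) auto
  with Inl assms show ?thesis
    by (cases v; cases "hd v") (simp_all add: emb_def syl_defs Let_def)
next
  case (Inr b)
  with assms(3) obtain b' where "z = Inr b'" by (cases z) auto
  with Inr assms show ?thesis
    by (cases v; cases "hd v") (simp_all add: emb_def syl_defs Let_def)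
qed

lemma push_one:
  assumes "reduced w" "is_one x" "in_syl x"
  shows "push G H x w = w"
proof -
  obtain z v where "in_syl z" "isl z = isl x" "w = emb z @ v" "v = [] \<or> isl (hd v) \<noteq> isl x"
    by (rule split_emb_left[OF assms(1)])
  then show ?thesis
    using assms push_emb_append[of x z v] by (simp add: smul_one_left)
qed

lemma reduced_push:
  assumes "in_syl x" "reduced w"
  shows "reduced (push G H x w)"
proof -
  obtain z v where "in_syl z" "isl z = isl x" "w = emb z @ v" "reduced v"
    "v = [] \<or> isl (hd v) \<noteq> isl x"
    by (rule split_emb_left[OF assms(2)])
  then show ?thesis
    using assms(1) push_emb_append[of x z v] reduced_emb_append[of "smul x z" v] in_syl_smul[of x z]
    by simp
qed

text \<open>The action law for each factor. It reduces to associativity in that factor, applied to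
  the split-off first syllable of \<open>w\<close>.\<close>

lemma push_push:
  assumes "in_syl x" "in_syl y" "isl x = isl y" "reduced w"
  shows "push G H x (push G H y w) = push G H (smul x y) w"
proof -
  obtain z v where z: "in_syl z" "isl z = isl x" "w = emb z @ v" "v = [] \<or> isl (hd v) \<noteq> isl x"
    by (rule split_emb_left[OF assms(4)])
  have "push G H x (push G H y w) = push G H x (emb (smul y z) @ v)"
    using z assms push_emb_append[of y z v] by simp
  also have "\<dots> = emb (smul (smul x y) z) @ v"
    using z assms push_emb_append[of x "smul y z" v] in_syl_smul[of y z] by (simp add: smul_assoc)
  also have "\<dots> = push G H (smul x y) w"
    using z assms push_emb_append[of "smul x y" z v] in_syl_smul[of x y] by simp
  finally show ?thesis .
qed

lemma push_Cons: "reduced (x # w) \<Longrightarrow> push G H x w = x # w"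
proof -
  assume xw: "reduced (x # w)"
  obtain e where e: "in_syl e" "is_one e" "isl e = isl x" using one_exists by blast
  then have "push G H x (emb e @ w) = emb (smul x e) @ w"
    using xw by (intro push_emb_append) (auto simp: reduced_Cons)
  then show ?thesis using e xw by (simp add: emb_def smul_one_right reduced_Cons)
qed

lemma reduced_foldr_push: "reduced u \<Longrightarrow> reduced v \<Longrightarrow> reduced (foldr (push G H) u v)"
  by (induction u) (auto simp: reduced_Cons reduced_push)

lemma foldr_push_append: "reduced (u @ v) \<Longrightarrow> foldr (push G H) u v = u @ v"
  by (induction u) (simp_all add: push_Cons, simp add: reduced_Cons push_Cons)

lemma foldr_push_emb: "in_syl x \<Longrightarrow> reduced w \<Longrightarrow> foldr (push G H) (emb x) w = push G H x w"
  by (auto simp: emb_def push_one)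

text \<open>Associativity for a single syllable on the left. Pushing \<open>x\<close> onto
  \<open>v\<close> changes only the first syllable of \<open>v\<close>, and the action law
  \<open>push_push\<close> separates the two again.\<close>

lemma foldr_push_push:
  assumes "in_syl x" "reduced v" "reduced w"
  shows "foldr (push G H) (push G H x v) w = push G H x (foldr (push G H) v w)"
proof -
  obtain z ys where z: "in_syl z" "isl z = isl x" "v = emb z @ ys" "reduced ys"
    "ys = [] \<or> isl (hd ys) \<noteq> isl x"
    by (rule split_emb_left[OF assms(2)])
  have r: "reduced (foldr (push G H) ys w)" by (intro reduced_foldr_push z(4) assms(3))
  have "foldr (push G H) (push G H x v) w = foldr (push G H) (emb (smul x z) @ ys) w"
    using z assms(1) push_emb_append[of x z ys] by simp
  also have "\<dots> = push G H (smul x z) (foldr (push G H) ys w)"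
    using z assms(1) r by (simp add: foldr_push_emb in_syl_smul)
  also have "\<dots> = push G H x (push G H z (foldr (push G H) ys w))"
    using z assms(1) r by (simp add: push_push)
  also have "\<dots> = push G H x (foldr (push G H) v w)"
    using z r by (simp add: foldr_push_emb)
  finally show ?thesis .
qed

lemma foldr_push_assoc:
  assumes "reduced u" "reduced v" "reduced w"
  shows "foldr (push G H) (foldr (push G H) u v) w
    = foldr (push G H) u (foldr (push G H) v w)"
  using assms(1)
  by (induction u) (auto simp: assms reduced_Cons foldr_push_push reduced_foldr_push)

section \<open>Group laws and the embeddings of the factors\<close>

lemma carrier_P: "carrier P = {w. reduced w}"
  and one_P: "\<one>\<^bsub>P\<^esub> = []"
  and mult_P: "u \<otimes>\<^bsub>P\<^esub> v = foldr (push G H) u v"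
  by (simp_all add: free_product_def)

lemmas P_simps = carrier_P one_P mult_P

lemma monoid_free_product: "monoid P"
  by (rule monoidI) (auto simp: P_simps reduced_foldr_push foldr_push_assoc foldr_push_append[of _ "[]", simplified])

lemma emb_mult: "in_syl x \<Longrightarrow> in_syl y \<Longrightarrow> isl x = isl y \<Longrightarrow> emb x \<otimes>\<^bsub>P\<^esub> emb y = emb (smul x y)"
  using push_emb_append[of x y "[]"] by (simp add: mult_P foldr_push_emb reduced_emb)

text \<open>Associativity moves the product to the last syllable, where it is computed in the
  factor. Since \<open>v\<close> does not end on that side, nothing before it can cancel.\<close>

lemma append_emb_mult:
  assumes "in_syl x" "in_syl y" "isl x = isl y" "reduced v" "v = [] \<or> isl (last v) \<noteq> isl x"
  shows "(v @ emb x) \<otimes>\<^bsub>P\<^esub> emb y = v @ emb (smul x y)"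
proof -
  have "(v @ emb x) \<otimes>\<^bsub>P\<^esub> emb y = v \<otimes>\<^bsub>P\<^esub> (emb x \<otimes>\<^bsub>P\<^esub> emb y)" by (simp add: mult_P)
  also have "\<dots> = v \<otimes>\<^bsub>P\<^esub> emb (smul x y)" using assms by (simp add: emb_mult)
  also have "\<dots> = v @ emb (smul x y)"
    unfolding mult_P using assms by (intro foldr_push_append reduced_append_emb in_syl_smul) auto
  finally show ?thesis .
qed

text \<open>Left inverses are built by induction on the word: if \<open>v\<close> inverts
  \<open>u\<close> and \<open>y\<close> inverts \<open>x\<close> in its factor, then
  \<open>v\<close> times \<open>emb y\<close> inverts \<open>x # u\<close>.\<close>

lemma group_free_product: "group P"
proof (rule monoid.group_l_invI[OF monoid_free_product])
  interpret P: monoid P by (rule monoid_free_product)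
  fix u assume "u \<in> carrier P"
  then have "reduced u" by (simp add: carrier_P)
  then have "\<exists>v. reduced v \<and> v \<otimes>\<^bsub>P\<^esub> u = []"
  proof (induction u)
    case Nil
    show ?case by (intro exI[of _ "[]"]) (simp add: mult_P)
  next
    case (Cons x u)
    then have x: "in_syl x" "\<not> is_one x" "reduced u" by (auto simp: reduced_Cons)
    then obtain v where v: "reduced v" "v \<otimes>\<^bsub>P\<^esub> u = []" using Cons.IH by blast
    obtain y where y: "in_syl y" "isl y = isl x" "is_one (smul y x)"
      using sinv_exists[OF x(1)] by blast
    have car: "u \<in> carrier P" "v \<in> carrier P" "emb x \<in> carrier P" "emb y \<in> carrier P"
      using x y v by (auto simp: carrier_P reduced_emb)
    have "x # u = emb x \<otimes>\<^bsub>P\<^esub> u"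
      using x Cons.prems by (simp add: mult_P emb_def push_Cons)
    then have "(v \<otimes>\<^bsub>P\<^esub> emb y) \<otimes>\<^bsub>P\<^esub> (x # u) = v \<otimes>\<^bsub>P\<^esub> ((emb y \<otimes>\<^bsub>P\<^esub> emb x) \<otimes>\<^bsub>P\<^esub> u)"
      using car by (simp add: P.m_assoc)
    also have "emb y \<otimes>\<^bsub>P\<^esub> emb x = \<one>\<^bsub>P\<^esub>"
      using x y by (simp add: emb_mult one_P) (simp add: emb_def)
    finally have "(v \<otimes>\<^bsub>P\<^esub> emb y) \<otimes>\<^bsub>P\<^esub> (x # u) = []"
      using car v by simp
    moreover have "reduced (v \<otimes>\<^bsub>P\<^esub> emb y)"
      using P.m_closed[OF car(2,4)] by (simp add: carrier_P)
    ultimately show ?case by blast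
  qed
  then show "\<exists>v \<in> carrier P. v \<otimes>\<^bsub>P\<^esub> u = \<one>\<^bsub>P\<^esub>"
    by (auto simp: carrier_P one_P)
qed

lemma hom_Inl: "group_hom G P (\<lambda>a. emb (Inl a))"
  unfolding group_hom_def group_hom_axioms_def hom_def
  by (auto simp: G.group_axioms group_free_product emb_mult carrier_P reduced_emb in_syl_def smul_def)

lemma hom_Inr: "group_hom H P (\<lambda>b. emb (Inr b))"
  unfolding group_hom_def group_hom_axioms_def hom_def
  by (auto simp: H.group_axioms group_free_product emb_mult carrier_P reduced_emb in_syl_def smul_def)

lemma inj_emb_Inl: "inj (\<lambda>a. emb (Inl a))"
  by (auto simp: inj_def emb_def is_one_def split: if_splits)

lemma inj_emb_Inr: "inj (\<lambda>b. emb (Inr b))"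
  by (auto simp: inj_def emb_def is_one_def split: if_splits)

text \<open>A reduced word is the product of its syllables, so it suffices to generate
  these.\<close>

lemma generate_emb:
  assumes "C \<subseteq> carrier P" "\<And>x. in_syl x \<Longrightarrow> emb x \<in> generate P C"
  shows "generate P C = carrier P"
proof
  interpret P: group P by (rule group_free_product)
  show "generate P C \<subseteq> carrier P" by (rule P.generate_incl[OF assms(1)])
  have "w \<in> generate P C" if "reduced w" for w
    using that
  proof (induction w)
    case Nil
    show ?case using generate.one[of P C] by (simp add: one_P)
  next
    case (Cons x w)
    then have "emb x \<in> generate P C" "w \<in> generate P C"
      using assms(2) by (auto simp: reduced_Cons)
    moreover have "x # w = emb x \<otimes>\<^bsub>P\<^esub> w"
      using Cons.prems by (simp add: mult_P emb_def push_Cons) (simp add: reduced_Cons)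
    ultimately show ?case using generate.eng by metis
  qed
  then show "carrier P \<subseteq> generate P C" by (auto simp: carrier_P)
qed

end

section \<open>Word length and representations of a single group\<close>

text \<open>Distance from the identity, to which the left-invariant word metric reduces.\<close>

definition word_len :: "('a, 'm) monoid_scheme \<Rightarrow> 'a set \<Rightarrow> 'a \<Rightarrow> nat" where
  "word_len G A g = (LEAST n. \<exists>w\<in>lists (sym_gens G A). length w = n \<and> eval_word G w = g)"

lemma word_metric_eq_word_len: "word_metric G A g h = word_len G A (inv\<^bsub>G\<^esub> g \<otimes>\<^bsub>G\<^esub> h)"
  by (simp add: word_metric_def word_len_def)

lemma word_len_le:
  assumes "w \<in> lists (sym_gens G A)"
  shows "word_len G A (eval_word G w) \<le> length w"
  unfolding word_len_def by (rule Least_le) (use assms in blast)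

lemma finite_sym_gens: "finite A \<Longrightarrow> finite (sym_gens G A)"
  by (simp add: sym_gens_def)

text \<open>Needed because \<open>Max\<close> is meaningful only on finite sets; there are finitely
  many words of bounded length over a finite alphabet.\<close>

lemma finite_rep_fun_set:
  assumes "finite A" "L \<subseteq> lists (sym_gens G A)"
  shows "finite {word_metric G A (eval_word G w) (\<psi> w) | w. w \<in> L \<and> length w \<le> n}"
proof -
  have "finite {w. set w \<subseteq> sym_gens G A \<and> length w \<le> n}"
    by (rule finite_lists_length_le[OF finite_sym_gens[OF assms(1)]])
  then have "finite {w. w \<in> L \<and> length w \<le> n}"
    by (rule finite_subset[rotated]) (use assms(2) in auto)
  then show ?thesis by simp
qed

lemma rep_fun_ge:
  assumes "finite A" "L \<subseteq> lists (sym_gens G A)" "w \<in> L" "length w \<le> n"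
  shows "real (word_metric G A (eval_word G w) (\<psi> w)) \<le> rep_fun G A L \<psi> n"
proof -
  let ?D = "{word_metric G A (eval_word G w) (\<psi> w) | w. w \<in> L \<and> length w \<le> n}"
  have "word_metric G A (eval_word G w) (\<psi> w) \<in> ?D" using assms by blast
  then show ?thesis
    using Max_ge[OF finite_rep_fun_set[OF assms(1,2)]] by (auto simp: rep_fun_def Let_def)
qed

text \<open>The condition \<open>0 \<le> b\<close> covers the default value \<open>0\<close>, taken
  when \<open>L\<close> has no word of length at most \<open>n\<close>.\<close>

lemma rep_fun_le:
  assumes "finite A" "L \<subseteq> lists (sym_gens G A)" "0 \<le> b"
    and "\<And>w. w \<in> L \<Longrightarrow> length w \<le> n \<Longrightarrow> real (word_metric G A (eval_word G w) (\<psi> w)) \<le> b"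
  shows "rep_fun G A L \<psi> n \<le> b"
proof -
  let ?D = "{word_metric G A (eval_word G w) (\<psi> w) | w. w \<in> L \<and> length w \<le> n}"
  have "real (Max ?D) \<le> b" if "?D \<noteq> {}"
    using Max_in[OF finite_rep_fun_set[OF assms(1,2)] that] assms(4) by auto
  then show ?thesis using assms(3) unfolding rep_fun_def Let_def by presburger
qed

locale gen_group = group G for G :: "('a, 'm) monoid_scheme" +
  fixes A :: "'a set"
  assumes gens_subset: "A \<subseteq> carrier G"
    and gens_generate: "generate G A = carrier G"
begin

lemma sym_gens_subset: "sym_gens G A \<subseteq> carrier G"
  using gens_subset by (auto simp: sym_gens_def)

lemma inv_sym_gens: "x \<in> sym_gens G A \<Longrightarrow> inv\<^bsub>G\<^esub> x \<in> sym_gens G A"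
  using gens_subset by (auto simp: sym_gens_def)

lemma eval_word_closed: "w \<in> lists (sym_gens G A) \<Longrightarrow> eval_word G w \<in> carrier G"
  using sym_gens_subset by (induction w) (auto simp: eval_word_def)

lemma eval_word_append:
  "u \<in> lists (sym_gens G A) \<Longrightarrow> v \<in> lists (sym_gens G A) \<Longrightarrow>
    eval_word G (u @ v) = eval_word G u \<otimes>\<^bsub>G\<^esub> eval_word G v"
proof (induction u)
  case Nil
  then show ?case using eval_word_closed by (simp add: eval_word_def)
next
  case (Cons x u)
  then have "x \<in> carrier G" "eval_word G u \<in> carrier G" "eval_word G v \<in> carrier G"
    using sym_gens_subset eval_word_closed by auto
  with Cons show ?case by (simp add: eval_word_def m_assoc)
qed

lemma exists_word:
  assumes "g \<in> carrier G"
  shows "\<exists>w\<in>lists (sym_gens G A). eval_word G w = g"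
proof -
  have "g \<in> generate G A" using assms gens_generate by simp
  then show ?thesis
  proof induction
    case one
    show ?case by (rule bexI[of _ "[]"]) (auto simp: eval_word_def)
  next
    case (incl h)
    then show ?case
      using gens_subset by (intro bexI[of _ "[h]"]) (auto simp: eval_word_def sym_gens_def)
  next
    case (inv h)
    then show ?case
      using gens_subset by (intro bexI[of _ "[inv\<^bsub>G\<^esub> h]"]) (auto simp: eval_word_def sym_gens_def)
  next
    case (eng h1 h2)
    then obtain u v where "u \<in> lists (sym_gens G A)" "eval_word G u = h1"
      "v \<in> lists (sym_gens G A)" "eval_word G v = h2" by blast
    then show ?case by (intro bexI[of _ "u @ v"]) (auto simp: eval_word_append)
  qed
qed

text \<open>The \<open>LEAST\<close> ranges over a nonempty set because \<open>A\<close> generates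
  the group.\<close>

lemma word_len_attained:
  assumes "g \<in> carrier G"
  obtains w where "w \<in> lists (sym_gens G A)" "length w = word_len G A g" "eval_word G w = g"
proof -
  have "\<exists>n. \<exists>w\<in>lists (sym_gens G A). length w = n \<and> eval_word G w = g"
    using exists_word[OF assms] by blast
  from LeastI_ex[OF this] show thesis using that unfolding word_len_def by blast
qed

lemma word_len_mult:
  assumes "g \<in> carrier G" "h \<in> carrier G"
  shows "word_len G A (g \<otimes>\<^bsub>G\<^esub> h) \<le> word_len G A g + word_len G A h"
proof -
  obtain u v where "u \<in> lists (sym_gens G A)" "length u = word_len G A g" "eval_word G u = g"
    "v \<in> lists (sym_gens G A)" "length v = word_len G A h" "eval_word G v = h"
    using word_len_attained[OF assms(1)] word_len_attained[OF assms(2)] by metis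
  then show ?thesis using word_len_le[of "u @ v" G A] by (simp add: eval_word_append)
qed

lemma word_len_one: "word_len G A \<one>\<^bsub>G\<^esub> = 0"
  using word_len_le[of "[]" G A] by (simp add: eval_word_def)

text \<open>Reversing a word and inverting its letters gives a word of the same length for the
  inverse element.\<close>

lemma word_len_inv_eval:
  assumes "w \<in> lists (sym_gens G A)"
  shows "word_len G A (inv\<^bsub>G\<^esub> eval_word G w) \<le> length w"
proof -
  have "\<exists>v\<in>lists (sym_gens G A). length v = length w \<and> eval_word G v = inv\<^bsub>G\<^esub> eval_word G w"
    using assms
  proof (induction w)
    case Nil
    show ?case by (rule bexI[of _ "[]"]) (auto simp: eval_word_def)
  next
    case (Cons x w)
    then obtain v where v: "v \<in> lists (sym_gens G A)" "length v = length w"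
      "eval_word G v = inv\<^bsub>G\<^esub> eval_word G w" by auto
    have x: "x \<in> carrier G" "x \<in> sym_gens G A" "eval_word G w \<in> carrier G"
      using Cons.hyps sym_gens_subset eval_word_closed by auto
    have "eval_word G (v @ [inv\<^bsub>G\<^esub> x]) = inv\<^bsub>G\<^esub> eval_word G (x # w)"
      using v x inv_sym_gens by (simp add: eval_word_append) (simp add: eval_word_def inv_mult_group)
    then show ?case using v x inv_sym_gens by (intro bexI[of _ "v @ [inv\<^bsub>G\<^esub> x]"]) auto
  qed
  then show ?thesis using word_len_le by metis
qed

lemma word_metric_eq_0_imp_eq:
  assumes "g \<in> carrier G" "h \<in> carrier G" "word_metric G A g h = 0"
  shows "g = h"
proof -
  have "inv\<^bsub>G\<^esub> g \<otimes>\<^bsub>G\<^esub> h \<in> carrier G" using assms by simp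
  then obtain w where "length w = (0::nat)" "eval_word G w = inv\<^bsub>G\<^esub> g \<otimes>\<^bsub>G\<^esub> h"
    using word_len_attained assms(3) by (metis word_metric_eq_word_len)
  then have "inv\<^bsub>G\<^esub> g \<otimes>\<^bsub>G\<^esub> h = \<one>\<^bsub>G\<^esub>" by (simp add: eval_word_def)
  then show ?thesis using assms by (metis inv_closed inv_equality inv_inv)
qed

lemma word_metric_self: "g \<in> carrier G \<Longrightarrow> word_metric G A g g = 0"
  by (simp add: word_metric_eq_word_len word_len_one)

end

section \<open>Normal forms given by a Cayley automatic representation\<close>

locale cayley_rep = gen_group G A for G :: "('a, 'm) monoid_scheme" and A :: "'a set" +
  fixes L :: "'a list set" and \<psi> :: "'a list \<Rightarrow> 'a"
  assumes finite_gens: "finite A" and rep: "cayley_aut_rep G A L \<psi>"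
begin

definition nf :: "'a \<Rightarrow> 'a list" where
  "nf = inv_into L \<psi>"

lemma fin_deriv_L: "fin_deriv L" and L_subset: "L \<subseteq> lists (sym_gens G A)"
  and bij_psi: "bij_betw \<psi> L (carrier G)"
  using rep regular_lang_imp_fin_deriv unfolding cayley_aut_rep_def by blast+

lemma bij_nf: "bij_betw nf (carrier G) L"
  unfolding nf_def by (rule bij_betw_inv_into[OF bij_psi])

lemma nf_in_L: "g \<in> carrier G \<Longrightarrow> nf g \<in> L"
  using bij_nf by (auto simp: bij_betw_def)

lemma nf_in_lists: "g \<in> carrier G \<Longrightarrow> nf g \<in> lists (sym_gens G A)"
  using nf_in_L L_subset by blast

lemma psi_nf: "g \<in> carrier G \<Longrightarrow> \<psi> (nf g) = g"
  unfolding nf_def by (rule bij_betw_inv_into_right[OF bij_psi])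

lemma nf_eq_iff: "g \<in> carrier G \<Longrightarrow> h \<in> carrier G \<Longrightarrow> nf g = nf h \<longleftrightarrow> g = h"
  using psi_nf by metis

lemma nf_psi: "u \<in> L \<Longrightarrow> \<psi> u \<in> carrier G" "u \<in> L \<Longrightarrow> nf (\<psi> u) = u"
  unfolding nf_def using bij_betwE[OF bij_psi] bij_betw_inv_into_left[OF bij_psi] by blast+

text \<open>As \<open>nf\<close> is a bijection onto \<open>L\<close>, leaving out the identity
  removes exactly one word from \<open>L\<close>. A fixed prefix and a letter map then preserve
  regularity.\<close>

lemma fin_deriv_blocks:
  "fin_deriv {p @ map e (nf g) | g. g \<in> carrier G \<and> g \<noteq> \<one>\<^bsub>G\<^esub>}"
proof -
  have "nf ` (carrier G - {\<one>\<^bsub>G\<^esub>}) = L - {nf \<one>\<^bsub>G\<^esub>}"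
    using inj_on_image_set_diff[of nf "carrier G" "carrier G" "{\<one>\<^bsub>G\<^esub>}"] bij_nf
    unfolding bij_betw_def by simp
  moreover have "lconc {p} (map e ` nf ` (carrier G - {\<one>\<^bsub>G\<^esub>}))
      = {p @ map e (nf g) | g. g \<in> carrier G \<and> g \<noteq> \<one>\<^bsub>G\<^esub>}"
    unfolding lconc_def by (simp add: image_image) blast
  moreover have "fin_deriv (lconc {p} (map e ` (L - {nf \<one>\<^bsub>G\<^esub>})))"
    by (intro fin_deriv_lconc fin_deriv_map fin_deriv_Diff fin_deriv_L fin_deriv_finite) auto
  ultimately show ?thesis by metis
qed

lemma mult_rel_eq:
  assumes "a \<in> carrier G"
  shows "{(u, v). u \<in> L \<and> v \<in> L \<and> \<psi> v = \<psi> u \<otimes>\<^bsub>G\<^esub> a} = {(nf g, nf (g \<otimes>\<^bsub>G\<^esub> a)) | g. g \<in> carrier G}"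
    (is "?l = ?r")
proof
  show "?l \<subseteq> ?r"
  proof clarify
    fix u v assume *: "u \<in> L" "v \<in> L" "\<psi> v = \<psi> u \<otimes>\<^bsub>G\<^esub> a"
    then show "\<exists>g. (u, v) = (nf g, nf (g \<otimes>\<^bsub>G\<^esub> a)) \<and> g \<in> carrier G"
      using nf_psi[OF *(1)] nf_psi[OF *(2)] by (intro exI[of _ "\<psi> u"]) simp
  qed
  show "?r \<subseteq> ?l"
    using assms by (auto simp: nf_in_L psi_nf)
qed

text \<open>The block of the identity is empty, unlike the prefixed representatives of the other
  elements. This affects only pairs in which \<open>g\<close> or its product with \<open>a\<close>
  is the identity, that is, at most two values of \<open>g\<close>. Their convolutions are removed
  from the given relation and the corrected ones added as a finite set; all other pairs just receive
  the common prefix \<open>p\<close>.\<close>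

lemma fin_deriv_mult_blocks:
  assumes "a \<in> A" and blk: "blk = (\<lambda>g. if g = \<one>\<^bsub>G\<^esub> then [] else p @ map e (nf g))"
  shows "fin_deriv {conv (blk g) (blk (g \<otimes>\<^bsub>G\<^esub> a)) | g. g \<in> carrier G}"
proof -
  let ?h = "map_prod (map_option e) (map_option e)"
  let ?R = "{conv (nf g) (nf (g \<otimes>\<^bsub>G\<^esub> a)) | g. g \<in> carrier G}"
  let ?bad = "{conv (nf g) (nf (g \<otimes>\<^bsub>G\<^esub> a)) | g. g \<in> {\<one>\<^bsub>G\<^esub>, inv\<^bsub>G\<^esub> a}}"
  let ?F = "{conv (blk g) (blk (g \<otimes>\<^bsub>G\<^esub> a)) | g. g \<in> {\<one>\<^bsub>G\<^esub>, inv\<^bsub>G\<^esub> a}}"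
  have a: "a \<in> carrier G" using assms gens_subset by blast
  have "?R = (\<lambda>(u, v). conv u v) ` {(u, v). u \<in> L \<and> v \<in> L \<and> \<psi> v = \<psi> u \<otimes>\<^bsub>G\<^esub> a}"
    unfolding mult_rel_eq[OF a] by force
  then have R: "fin_deriv ?R"
    using rep assms(1) by (auto simp: cayley_aut_rep_def fa_recognizable_def intro: regular_lang_imp_fin_deriv)
  \<comment> \<open>A convolution determines its first word and hence \<open>g\<close>, so
    subtracting \<open>?bad\<close> removes no further pair.\<close>
  have conv_nf_inj: "g = g'" if "conv (nf g) x = conv (nf g') y" "g \<in> carrier G" "g' \<in> carrier G" for g g' x y
    using that map_the_filter_conv(1) nf_eq_iff by metis
  have Diff: "?R - ?bad = {conv (nf g) (nf (g \<otimes>\<^bsub>G\<^esub> a)) | g. g \<in> carrier G - {\<one>\<^bsub>G\<^esub>, inv\<^bsub>G\<^esub> a}}"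
    using conv_nf_inj a by (auto; blast)
  have not_one: "g \<otimes>\<^bsub>G\<^esub> a \<noteq> \<one>\<^bsub>G\<^esub>" if "g \<in> carrier G" "g \<noteq> inv\<^bsub>G\<^esub> a" for g
    using that a inv_equality by metis
  have "conv (blk g) (blk (g \<otimes>\<^bsub>G\<^esub> a)) = conv p p @ map ?h (conv (nf g) (nf (g \<otimes>\<^bsub>G\<^esub> a)))"
    if "g \<in> carrier G - {\<one>\<^bsub>G\<^esub>, inv\<^bsub>G\<^esub> a}" for g
    using that not_one by (simp add: blk conv_append conv_map)
  then have "{conv (blk g) (blk (g \<otimes>\<^bsub>G\<^esub> a)) | g. g \<in> carrier G - {\<one>\<^bsub>G\<^esub>, inv\<^bsub>G\<^esub> a}}
      = lconc {conv p p} (map ?h ` (?R - ?bad))"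
    unfolding Diff lconc_def by (auto; force)
  moreover have "{conv (blk g) (blk (g \<otimes>\<^bsub>G\<^esub> a)) | g. g \<in> carrier G}
      = ?F \<union> {conv (blk g) (blk (g \<otimes>\<^bsub>G\<^esub> a)) | g. g \<in> carrier G - {\<one>\<^bsub>G\<^esub>, inv\<^bsub>G\<^esub> a}}"
    using a by blast
  moreover have "finite ?F"
    by (rule finite_subset[of _ "(\<lambda>g. conv (blk g) (blk (g \<otimes>\<^bsub>G\<^esub> a))) ` {\<one>\<^bsub>G\<^esub>, inv\<^bsub>G\<^esub> a}"]) auto
  moreover have "finite ?bad"
    by (rule finite_subset[of _ "(\<lambda>g. conv (nf g) (nf (g \<otimes>\<^bsub>G\<^esub> a))) ` {\<one>\<^bsub>G\<^esub>, inv\<^bsub>G\<^esub> a}"]) auto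
  ultimately show ?thesis
    using R by (simp only: fin_deriv_Un fin_deriv_finite fin_deriv_lconc fin_deriv_map fin_deriv_Diff
        finite.intros)
qed

text \<open>The triangle inequality through the element to which the representative of
  \<open>g\<close> evaluates.\<close>

lemma word_len_le_metric:
  assumes "g \<in> carrier G"
  shows "word_len G A g \<le> length (nf g) + word_metric G A (eval_word G (nf g)) g"
proof -
  let ?p = "eval_word G (nf g)"
  have p: "?p \<in> carrier G" using assms nf_in_lists eval_word_closed by blast
  have "?p \<otimes>\<^bsub>G\<^esub> (inv\<^bsub>G\<^esub> ?p \<otimes>\<^bsub>G\<^esub> g) = (?p \<otimes>\<^bsub>G\<^esub> inv\<^bsub>G\<^esub> ?p) \<otimes>\<^bsub>G\<^esub> g"
    using p assms by (intro m_assoc[symmetric]) auto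
  also have "\<dots> = g" using p assms by simp
  finally have "word_len G A g = word_len G A (?p \<otimes>\<^bsub>G\<^esub> (inv\<^bsub>G\<^esub> ?p \<otimes>\<^bsub>G\<^esub> g))" by simp
  also have "\<dots> \<le> word_len G A ?p + word_metric G A ?p g"
    unfolding word_metric_eq_word_len using p assms by (intro word_len_mult) auto
  finally have "word_len G A g \<le> word_len G A ?p + word_metric G A ?p g" .
  moreover have "word_len G A ?p \<le> length (nf g)" by (rule word_len_le[OF nf_in_lists[OF assms]])
  ultimately show ?thesis by linarith
qed

lemma metric_le_rep_fun:
  assumes "g \<in> carrier G" "length (nf g) \<le> n"
  shows "real (word_metric G A (eval_word G (nf g)) g) \<le> rep_fun G A L \<psi> n"
  using rep_fun_ge[OF finite_gens L_subset nf_in_L[OF assms(1)] assms(2), of \<psi>]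
  unfolding psi_nf[OF assms(1)] .

end

section \<open>Representatives with a marker in front\<close>

text \<open>The cancelling prefix \<open>a a\<^sup>-\<^sup>1\<close> makes every block start with a nonidentity letter: the
  identity may itself be a generator in both factors, and the empty word may represent a
  nonidentity element. The assumption on \<open>a\<close> is void for the trivial group.\<close>
locale marked_rep = cayley_rep G A L \<psi>
  for G :: "('a, 'm) monoid_scheme" and A L \<psi> +
  fixes a :: 'a
  assumes marker: "g \<in> carrier G \<Longrightarrow> g \<noteq> \<one>\<^bsub>G\<^esub> \<Longrightarrow> a \<in> A \<and> a \<noteq> \<one>\<^bsub>G\<^esub>"
begin

definition mnf :: "'a \<Rightarrow> 'a list" where
  "mnf g = (if g = \<one>\<^bsub>G\<^esub> then [] else a # inv\<^bsub>G\<^esub> a # nf g)"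

lemma mnf_in_lists:
  assumes "g \<in> carrier G"
  shows "mnf g \<in> lists (sym_gens G A)"
proof (cases "g = \<one>\<^bsub>G\<^esub>")
  case False
  then have "a \<in> sym_gens G A" using marker[OF assms] by (simp add: sym_gens_def)
  then show ?thesis
    unfolding mnf_def using nf_in_lists[OF assms] inv_sym_gens by (simp add: False)
qed (simp add: mnf_def)

lemma mnf_inj: "g \<in> carrier G \<Longrightarrow> h \<in> carrier G \<Longrightarrow> mnf g = mnf h \<Longrightarrow> g = h"
  by (auto simp: mnf_def nf_eq_iff split: if_splits)

lemma hd_mnf: "g \<in> carrier G \<Longrightarrow> g \<noteq> \<one>\<^bsub>G\<^esub> \<Longrightarrow> hd (mnf g) \<noteq> \<one>\<^bsub>G\<^esub>"
  using marker by (simp add: mnf_def)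

text \<open>The marker cancels, so it leaves the distance to \<open>g\<close> unchanged. The
  identity is excluded because its block is empty, while its representative may evaluate to another
  element.\<close>

lemma eval_mnf:
  assumes "g \<in> carrier G" "g \<noteq> \<one>\<^bsub>G\<^esub>"
  shows "eval_word G (mnf g) = eval_word G (nf g)"
proof -
  have a: "a \<in> carrier G" using marker[OF assms] gens_subset by blast
  have p: "eval_word G (nf g) \<in> carrier G" using assms(1) nf_in_lists eval_word_closed by blast
  have "eval_word G (mnf g) = a \<otimes>\<^bsub>G\<^esub> (inv\<^bsub>G\<^esub> a \<otimes>\<^bsub>G\<^esub> eval_word G (nf g))"
    using assms(2) by (simp add: mnf_def eval_word_def)
  also have "\<dots> = (a \<otimes>\<^bsub>G\<^esub> inv\<^bsub>G\<^esub> a) \<otimes>\<^bsub>G\<^esub> eval_word G (nf g)"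
    using a p by (intro m_assoc[symmetric]) auto
  finally show ?thesis using a p by simp
qed

lemma fin_deriv_mnf: "fin_deriv {map e (mnf g) | g. g \<in> carrier G \<and> g \<noteq> \<one>\<^bsub>G\<^esub>}"
proof -
  have "{map e (mnf g) | g. g \<in> carrier G \<and> g \<noteq> \<one>\<^bsub>G\<^esub>}
      = {[e a, e (inv\<^bsub>G\<^esub> a)] @ map e (nf g) | g. g \<in> carrier G \<and> g \<noteq> \<one>\<^bsub>G\<^esub>}"
    by (rule Collect_cong, rule ex_cong1) (auto simp: mnf_def)
  then show ?thesis using fin_deriv_blocks[of "[e a, e (inv\<^bsub>G\<^esub> a)]" e] by simp
qed

lemma fin_deriv_mult_mnf:
  assumes "x \<in> A"
  shows "fin_deriv {conv (map e (mnf g)) (map e (mnf (g \<otimes>\<^bsub>G\<^esub> x))) | g. g \<in> carrier G}"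
proof -
  have "(\<lambda>g. map e (mnf g)) = (\<lambda>g. if g = \<one>\<^bsub>G\<^esub> then [] else [e a, e (inv\<^bsub>G\<^esub> a)] @ map e (nf g))"
    by (auto simp: mnf_def)
  from fin_deriv_mult_blocks[OF assms this] show ?thesis .
qed

lemma word_len_le_mnf:
  assumes "g \<in> carrier G" "g \<noteq> \<one>\<^bsub>G\<^esub>"
  shows "word_len G A g \<le> length (mnf g) + word_metric G A (eval_word G (nf g)) g"
  using word_len_le_metric[OF assms(1)] assms(2) by (simp add: mnf_def)

text \<open>Turns an eventual bound into one for every block. Stating it for all larger
  \<open>K\<close> and \<open>M\<close> allows both factors to share the same constants.\<close>

lemma metric_le_f_mnf:
  assumes "fun_preceq (rep_fun G A L \<psi>) f"
    and f: "\<And>n m. Q \<le> n \<Longrightarrow> n \<le> m \<Longrightarrow> 0 \<le> f n \<and> f n \<le> f m"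
  shows "\<exists>K0 M0. \<forall>K\<ge>K0. \<forall>M\<ge>M0. \<forall>g\<in>carrier G. g \<noteq> \<one>\<^bsub>G\<^esub> \<longrightarrow>
    real (word_metric G A (eval_word G (nf g)) g) \<le> real K * f (M * length (mnf g))"
proof -
  obtain N K0 M0 :: nat where K0: "M0 > 0" "\<And>n. N \<le> n \<Longrightarrow> rep_fun G A L \<psi> n \<le> real K0 * f (M0 * n)"
    using assms(1) unfolding fun_preceq_def by blast
  define N' where "N' = max N Q"
  show ?thesis
  proof (intro exI allI impI ballI)
    fix K M g
    assume K: "K0 \<le> K" and M: "M0 * (N' + 1) \<le> M" and g: "g \<in> carrier G" "g \<noteq> \<one>\<^bsub>G\<^esub>"
    let ?n = "length (nf g)"
    have len: "length (mnf g) = ?n + 2" using g by (simp add: mnf_def)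
    have "N' \<le> ?n + N'" by simp
    also have "\<dots> \<le> M0 * (?n + N')" using K0(1) by simp
    finally have Q: "Q \<le> M0 * (?n + N')" by (simp add: N'_def)
    \<comment> \<open>The shift by \<open>N'\<close> brings the argument past both thresholds.
      Because a block has positive length, the shift is absorbed by the factor
      \<open>N' + 1\<close>.\<close>
    have "?n + N' \<le> (N' + 1) * (?n + 2)" by (simp add: algebra_simps)
    then have "M0 * (?n + N') \<le> M0 * ((N' + 1) * (?n + 2))" by (rule mult_le_mono2)
    also have "\<dots> \<le> M * (?n + 2)" using mult_le_mono1[OF M, of "?n + 2"] by (simp only: mult.assoc)
    finally have le: "M0 * (?n + N') \<le> M * length (mnf g)" by (simp only: len)
    have "real (word_metric G A (eval_word G (nf g)) g) \<le> rep_fun G A L \<psi> (?n + N')"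
      by (rule metric_le_rep_fun[OF g(1)]) simp
    also have "\<dots> \<le> real K0 * f (M0 * (?n + N'))" by (rule K0(2)) (simp add: N'_def)
    also have "\<dots> \<le> real K * f (M * length (mnf g))"
      using f[OF Q le] f[of "M * length (mnf g)" "M * length (mnf g)"] Q le K
      by (intro mult_mono) auto
    finally show "real (word_metric G A (eval_word G (nf g)) g) \<le> real K * f (M * length (mnf g))" .
  qed
qed

text \<open>The value of \<open>rep_fun\<close> at \<open>n\<close> bounds the distance for all
  words of length at most \<open>n\<close>. Taking \<open>n\<close> beyond every threshold makes
  this bound zero, already for short representatives.\<close>

lemma eval_nf_if_f_eventually_0:
  assumes "fun_preceq (rep_fun G A L \<psi>) f" and f: "\<And>n. N0 \<le> n \<Longrightarrow> f n = 0" and g: "g \<in> carrier G"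
  shows "eval_word G (nf g) = g"
proof -
  obtain N K M :: nat where K: "M > 0" "\<And>n. N \<le> n \<Longrightarrow> rep_fun G A L \<psi> n \<le> real K * f (M * n)"
    using assms(1) unfolding fun_preceq_def by blast
  define n where "n = length (nf g) + N + N0"
  have "N0 \<le> n" by (simp add: n_def)
  also have "n \<le> M * n" using K(1) by simp
  finally have "f (M * n) = 0" by (rule f)
  then have "rep_fun G A L \<psi> n \<le> 0" using K(2)[of n] by (simp add: n_def)
  moreover have "real (word_metric G A (eval_word G (nf g)) g) \<le> rep_fun G A L \<psi> n"
    by (rule metric_le_rep_fun[OF g]) (simp add: n_def)
  ultimately have "word_metric G A (eval_word G (nf g)) g = 0" by simp
  then show ?thesis
    using g by (intro word_metric_eq_0_imp_eq eval_word_closed nf_in_lists)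
qed

end

text \<open>Identities generate only the trivial subgroup, so a nontrivial group has a nonidentity
  generator. For the trivial group any value will do.\<close>

lemma (in cayley_rep) marker_exists: "\<exists>a. marked_rep G A L \<psi> a"
proof -
  have "\<exists>a\<in>A. a \<noteq> \<one>\<^bsub>G\<^esub>" if "g \<in> carrier G" "g \<noteq> \<one>\<^bsub>G\<^esub>" for g
  proof (rule ccontr)
    assume "\<not> ?thesis"
    then have "A \<subseteq> {\<one>\<^bsub>G\<^esub>}" by blast
    then have "generate G A \<subseteq> {\<one>\<^bsub>G\<^esub>}" by (rule generate_subgroup_incl[OF _ triv_subgroup])
    then show False using that gens_generate by blast
  qed
  then obtain a where "\<And>g. g \<in> carrier G \<Longrightarrow> g \<noteq> \<one>\<^bsub>G\<^esub> \<Longrightarrow> a \<in> A \<and> a \<noteq> \<one>\<^bsub>G\<^esub>" by metis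
  then have "marked_rep G A L \<psi> a" by unfold_locales
  then show ?thesis ..
qed

section \<open>Representing the free product\<close>

lemma (in group_hom) eval_word_map:
  "w \<in> lists (carrier G) \<Longrightarrow> eval_word G w \<in> carrier G \<and> eval_word H (map h w) = h (eval_word G w)"
  by (induction w) (auto simp: eval_word_def)

lemma lstar_snoc:
  assumes "u \<in> lstar L" "v \<in> L"
  shows "u @ v \<in> lstar L"
proof -
  obtain ws where "ws \<in> lists L" "u = concat ws" using assms(1) by (auto simp: lstar_def)
  then show ?thesis
    using assms(2) unfolding lstar_def by (intro image_eqI[of _ _ "ws @ [v]"]) auto
qed

locale free_rep = two_groups G H + M1: marked_rep G A1 L1 \<psi>1 a1 + M2: marked_rep H A2 L2 \<psi>2 a2
  for G :: "('a, 'm) monoid_scheme" and H :: "('b, 'n) monoid_scheme"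
    and A1 L1 \<psi>1 a1 A2 L2 \<psi>2 a2
begin

abbreviation embl :: "'a \<Rightarrow> ('a + 'b) list" where "embl g \<equiv> emb (Inl g)"
abbreviation embr :: "'b \<Rightarrow> ('a + 'b) list" where "embr h \<equiv> emb (Inr h)"

text \<open>The letters are themselves elements of the free product, namely words of length at most
  one. An identity generator of either factor becomes the letter \<open>[]\<close>, from which the
  side can no longer be read.\<close>

definition gens :: "('a + 'b) list set" where
  "gens = embl ` A1 \<union> embr ` A2"

definition blk :: "'a + 'b \<Rightarrow> ('a + 'b) list list" where
  "blk x = (case x of Inl g \<Rightarrow> map embl (M1.mnf g) | Inr h \<Rightarrow> map embr (M2.mnf h))"

definition code :: "('a + 'b) list \<Rightarrow> ('a + 'b) list list" where
  "code xs = concat (map blk xs)"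

definition decode :: "('a + 'b) list list \<Rightarrow> ('a + 'b) list" where
  "decode = inv_into {xs. reduced xs} code"

definition blocks :: "bool \<Rightarrow> ('a + 'b) list list set" where
  "blocks s = {blk x | x. in_syl x \<and> \<not> is_one x \<and> isl x = s}"

text \<open>The codes after which any block of side \<open>s\<close> may be written without breaking
  the alternation.\<close>

definition codes_off :: "bool \<Rightarrow> ('a + 'b) list list set" where
  "codes_off s = {code xs | xs. reduced xs \<and> (xs = [] \<or> isl (last xs) \<noteq> s)}"

lemma code_simps [simp]: "code [] = []" "code (x # xs) = blk x @ code xs" "code (xs @ ys) = code xs @ code ys"
  by (simp_all add: code_def)

lemma blk_one: "is_one x \<Longrightarrow> blk x = []"
  by (cases x) (auto simp: blk_def is_one_def M1.mnf_def M2.mnf_def)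

lemma code_emb: "code (emb x) = blk x"
  by (simp add: emb_def blk_one)

lemma gens_subset: "gens \<subseteq> carrier P"
proof -
  interpret l: group_hom G P embl by (rule hom_Inl)
  interpret r: group_hom H P embr by (rule hom_Inr)
  show ?thesis using M1.gens_subset M2.gens_subset by (auto simp: gens_def)
qed

lemma generate_gens: "generate P gens = carrier P"
proof (rule generate_emb[OF gens_subset])
  interpret P: group P by (rule group_free_product)
  interpret l: group_hom G P embl by (rule hom_Inl)
  interpret r: group_hom H P embr by (rule hom_Inr)
  have "generate P (embl ` A1) \<subseteq> generate P gens" "generate P (embr ` A2) \<subseteq> generate P gens"
    by (auto simp: gens_def intro!: P.mono_generate)
  then have "embl ` carrier G \<subseteq> generate P gens" "embr ` carrier H \<subseteq> generate P gens"
    using l.generate_img[OF M1.gens_subset] r.generate_img[OF M2.gens_subset]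
    by (simp_all add: M1.gens_generate M2.gens_generate)
  then show "emb x \<in> generate P gens" if "in_syl x" for x
    using that by (cases x) (auto simp: in_syl_def)
qed

lemma gen_group_P: "gen_group P gens"
  unfolding gen_group_def gen_group_axioms_def
  using group_free_product gens_subset generate_gens by blast

lemma sym_gens_P: "sym_gens P gens = embl ` sym_gens G A1 \<union> embr ` sym_gens H A2"
proof -
  interpret l: group_hom G P embl by (rule hom_Inl)
  interpret r: group_hom H P embr by (rule hom_Inr)
  have "(\<lambda>x. inv\<^bsub>P\<^esub> x) ` embl ` A1 = embl ` (\<lambda>x. inv\<^bsub>G\<^esub> x) ` A1"
    unfolding image_image using M1.gens_subset by (intro image_cong) auto
  moreover have "(\<lambda>x. inv\<^bsub>P\<^esub> x) ` embr ` A2 = embr ` (\<lambda>x. inv\<^bsub>H\<^esub> x) ` A2"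
    unfolding image_image using M2.gens_subset by (intro image_cong) auto
  ultimately show ?thesis
    unfolding sym_gens_def gens_def by (simp only: image_Un Un_ac)
qed

lemma map_emb_in_lists:
  "w \<in> lists (sym_gens G A1) \<Longrightarrow> map embl w \<in> lists (sym_gens P gens)"
  "v \<in> lists (sym_gens H A2) \<Longrightarrow> map embr v \<in> lists (sym_gens P gens)"
  unfolding sym_gens_P in_lists_conv_set set_map by blast+

lemma blk_in_lists: "in_syl x \<Longrightarrow> blk x \<in> lists (sym_gens P gens)"
  by (cases x) (simp_all add: blk_def in_syl_def map_emb_in_lists M1.mnf_in_lists M2.mnf_in_lists)

lemma code_in_lists: "reduced xs \<Longrightarrow> code xs \<in> lists (sym_gens P gens)"
  by (induction xs) (auto simp: reduced_Cons dest: blk_in_lists)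

section \<open>Unique decoding\<close>

lemma blk_letter: "l \<in> set (blk x) \<Longrightarrow> l = [] \<or> isl (hd l) = isl x"
  by (cases x) (auto simp: blk_def emb_def)

text \<open>The first letter of a nontrivial block is the marker, which is not the identity; so its
  side is visible.\<close>

lemma hd_blk:
  assumes "in_syl x" "\<not> is_one x"
  shows "blk x \<noteq> []" "hd (blk x) \<noteq> []" "isl (hd (hd (blk x))) = isl x"
proof -
  have "blk x \<noteq> [] \<and> hd (blk x) \<noteq> [] \<and> isl (hd (hd (blk x))) = isl x"
  proof (cases x)
    case (Inl g)
    then have "M1.mnf g \<noteq> []" "hd (M1.mnf g) \<noteq> \<one>\<^bsub>G\<^esub>"
      using assms M1.hd_mnf by (auto simp: M1.mnf_def syl_defs)
    with Inl show ?thesis by (simp add: blk_def hd_map emb_def is_one_def)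
  next
    case (Inr h)
    then have "M2.mnf h \<noteq> []" "hd (M2.mnf h) \<noteq> \<one>\<^bsub>H\<^esub>"
      using assms M2.hd_mnf by (auto simp: M2.mnf_def syl_defs)
    with Inr show ?thesis by (simp add: blk_def hd_map emb_def is_one_def)
  qed
  then show "blk x \<noteq> []" "hd (blk x) \<noteq> []" "isl (hd (hd (blk x))) = isl x" by auto
qed

text \<open>The sides are assumed equal because the identities of both factors have the same empty
  block.\<close>

lemma blk_inj:
  assumes "in_syl x" "in_syl y" "isl x = isl y" "blk x = blk y"
  shows "x = y"
proof (cases x)
  case (Inl g)
  then obtain g' where y: "y = Inl g'" using assms(3) by (cases y) auto
  have "M1.mnf g = M1.mnf g'"
    using assms(4) inj_emb_Inl by (simp add: Inl y blk_def inj_map_eq_map)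
  then show ?thesis using assms(1,2) M1.mnf_inj by (simp add: Inl y in_syl_def)
next
  case (Inr h)
  then obtain h' where y: "y = Inr h'" using assms(3) by (cases y) auto
  have "M2.mnf h = M2.mnf h'"
    using assms(4) inj_emb_Inr by (simp add: Inr y blk_def inj_map_eq_map)
  then show ?thesis using assms(1,2) M2.mnf_inj by (simp add: Inr y in_syl_def)
qed

lemma hd_code:
  assumes "reduced xs" "xs \<noteq> []"
  shows "code xs \<noteq> []" "hd (code xs) \<noteq> []" "isl (hd (hd (code xs))) = isl (hd xs)"
  using assms hd_blk by (cases xs; auto simp: reduced_Cons)+

text \<open>Consecutive blocks alternate sides, so the first block ends where a nonidentity letter of
  the other side appears.\<close>
lemma takeWhile_code:
  assumes "reduced (x # xs)"
  shows "takeWhile (\<lambda>l. l = [] \<or> isl (hd l) = isl x) (code (x # xs)) = blk x"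
proof -
  let ?p = "\<lambda>l. l = [] \<or> isl (hd l) = isl x"
  have "takeWhile ?p (code xs) = []"
  proof (cases "xs = []")
    case False
    then have "reduced xs" "isl (hd xs) \<noteq> isl x" using assms by (auto simp: reduced_Cons)
    then have "code xs \<noteq> []" "\<not> ?p (hd (code xs))" using hd_code[of xs] False by auto
    then show ?thesis by (cases "code xs") auto
  qed simp
  then show ?thesis by (simp add: takeWhile_append2 blk_letter)
qed

text \<open>Blocks are peeled off from the left. The first letter tells the side, the longest prefix
  compatible with this side is the first block, and the block determines its syllable.\<close>

lemma code_inj: "reduced xs \<Longrightarrow> reduced ys \<Longrightarrow> code xs = code ys \<Longrightarrow> xs = ys"
proof (induction xs arbitrary: ys)
  case Nil
  then show ?case using hd_code(1)[of ys] by auto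
next
  case (Cons x xs)
  have "code (x # xs) \<noteq> []" using hd_code(1)[OF Cons.prems(1)] by simp
  then obtain y ys' where ys: "ys = y # ys'" using Cons.prems(3) by (cases ys) auto
  have "isl x = isl y"
    using hd_code(3)[OF Cons.prems(1)] hd_code(3)[OF Cons.prems(2)] Cons.prems(3) by (simp add: ys)
  then have "blk x = blk y"
    using takeWhile_code[OF Cons.prems(1)] takeWhile_code[of y ys'] Cons.prems(2,3) by (simp add: ys)
  moreover from this have "code xs = code ys'" using Cons.prems(3) by (simp add: ys)
  ultimately show ?case
    using Cons.prems(1,2) Cons.IH[of ys'] blk_inj[of x y] \<open>isl x = isl y\<close> by (simp add: ys reduced_Cons)
qed

lemma decode_code: "reduced xs \<Longrightarrow> decode (code xs) = xs"
  unfolding decode_def by (rule inv_into_f_f) (auto simp: inj_on_def code_inj)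

lemma bij_decode: "bij_betw decode (code ` {xs. reduced xs}) (carrier P)"
  unfolding decode_def carrier_P
  by (rule bij_betw_inv_into) (auto simp: bij_betw_def inj_on_def code_inj)

section \<open>Regularity of the codes and of the multiplication relations\<close>

lemma blocks_True: "blocks True = {map embl (M1.mnf g) | g. g \<in> carrier G \<and> g \<noteq> \<one>\<^bsub>G\<^esub>}"
  unfolding blocks_def
proof (rule Collect_cong, rule iffI)
  fix u assume "\<exists>x. u = blk x \<and> in_syl x \<and> \<not> is_one x \<and> isl x = True"
  then obtain x where "u = blk x" "in_syl x" "\<not> is_one x" "isl x" by blast
  then show "\<exists>g. u = map embl (M1.mnf g) \<and> g \<in> carrier G \<and> g \<noteq> \<one>\<^bsub>G\<^esub>"
    by (cases x) (auto simp: blk_def syl_defs)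
next
  fix u assume "\<exists>g. u = map embl (M1.mnf g) \<and> g \<in> carrier G \<and> g \<noteq> \<one>\<^bsub>G\<^esub>"
  then obtain g where "u = map embl (M1.mnf g)" "g \<in> carrier G" "g \<noteq> \<one>\<^bsub>G\<^esub>" by blast
  then show "\<exists>x. u = blk x \<and> in_syl x \<and> \<not> is_one x \<and> isl x = True"
    by (intro exI[of _ "Inl g"]) (auto simp: blk_def syl_defs)
qed

lemma blocks_False: "blocks False = {map embr (M2.mnf h) | h. h \<in> carrier H \<and> h \<noteq> \<one>\<^bsub>H\<^esub>}"
  unfolding blocks_def
proof (rule Collect_cong, rule iffI)
  fix u assume "\<exists>x. u = blk x \<and> in_syl x \<and> \<not> is_one x \<and> isl x = False"
  then obtain x where "u = blk x" "in_syl x" "\<not> is_one x" "\<not> isl x" by blast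
  then show "\<exists>h. u = map embr (M2.mnf h) \<and> h \<in> carrier H \<and> h \<noteq> \<one>\<^bsub>H\<^esub>"
    by (cases x) (auto simp: blk_def syl_defs)
next
  fix u assume "\<exists>h. u = map embr (M2.mnf h) \<and> h \<in> carrier H \<and> h \<noteq> \<one>\<^bsub>H\<^esub>"
  then obtain h where "u = map embr (M2.mnf h)" "h \<in> carrier H" "h \<noteq> \<one>\<^bsub>H\<^esub>" by blast
  then show "\<exists>x. u = blk x \<and> in_syl x \<and> \<not> is_one x \<and> isl x = False"
    by (intro exI[of _ "Inr h"]) (auto simp: blk_def syl_defs)
qed

lemma fin_deriv_side_blocks: "fin_deriv (blocks s)"
  using M1.fin_deriv_mnf[of embl] M2.fin_deriv_mnf[of embr]
  by (cases s) (simp_all add: blocks_True blocks_False)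

text \<open>Syllables are paired from the right, each pair consisting of one on side
  \<open>s\<close> followed by one on the other side. At most the first syllable stays unpaired, and
  it then lies off side \<open>s\<close>.\<close>

lemma code_in_lconc_lstar:
  assumes "reduced xs" "xs = [] \<or> isl (last xs) \<noteq> s"
  shows "code xs \<in> lconc (insert [] (blocks (\<not> s))) (lstar (lconc (blocks s) (blocks (\<not> s))))"
    (is "_ \<in> lconc ?E (lstar ?B)")
  using assms
proof (induction "length xs" arbitrary: xs rule: less_induct)
  case less
  have Nil: "[] \<in> lstar ?B" unfolding lstar_def by (rule image_eqI[of _ _ "[]"]) auto
  show ?case
  proof (cases xs rule: rev_cases)
    case Nil
    then show ?thesis using \<open>[] \<in> lstar ?B\<close> by (auto simp: lconc_def)
  next
    case (snoc ys y)
    have y: "in_syl y" "\<not> is_one y" "isl y \<noteq> s" "reduced ys" "ys = [] \<or> isl (last ys) \<noteq> isl y"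
      using less.prems by (auto simp: snoc reduced_append reduced_Cons)
    then have blky: "blk y \<in> blocks (\<not> s)" by (auto simp: blocks_def)
    show ?thesis
    proof (cases ys rule: rev_cases)
      case Nil
      have "blk y \<in> ?E" using blky by simp
      then have "blk y @ [] \<in> lconc ?E (lstar ?B)" using \<open>[] \<in> lstar ?B\<close> unfolding lconc_def by blast
      then show ?thesis by (simp add: snoc Nil)
    next
      case (snoc zs z)
      have z: "in_syl z" "\<not> is_one z" "isl z = s" "reduced zs" "zs = [] \<or> isl (last zs) \<noteq> s"
        using y by (auto simp: snoc reduced_append reduced_Cons)
      have "code zs \<in> lconc ?E (lstar ?B)"
        using z by (intro less.hyps) (simp_all add: \<open>xs = ys @ [y]\<close> snoc)
      then obtain u v where uv: "u \<in> ?E" "v \<in> lstar ?B" "code zs = u @ v" unfolding lconc_def by blast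
      have "blk z \<in> blocks s" using z by (auto simp: blocks_def)
      then have "blk z @ blk y \<in> ?B" using blky unfolding lconc_def by blast
      then have "v @ (blk z @ blk y) \<in> lstar ?B" by (rule lstar_snoc[OF uv(2)])
      then have "u @ (v @ (blk z @ blk y)) \<in> lconc ?E (lstar ?B)" using uv(1) unfolding lconc_def by blast
      then show ?thesis by (simp add: \<open>xs = ys @ [y]\<close> snoc uv(3))
    qed
  qed
qed

text \<open>Not ending on side \<open>s\<close> is the invariant: it allows the next pair of
  syllables to be appended, and the second of the pair restores it.\<close>

lemma lconc_lstar_in_codes_off:
  assumes "u \<in> insert [] (blocks (\<not> s))" "ws \<in> lists (lconc (blocks s) (blocks (\<not> s)))"
  shows "u @ concat ws \<in> codes_off s"
  using assms(2)
proof (induction ws rule: rev_induct)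
  case Nil
  have "\<exists>xs. u = code xs \<and> reduced xs \<and> (xs = [] \<or> isl (last xs) \<noteq> s)"
  proof (cases "u = []")
    case True
    then show ?thesis by (intro exI[of _ "[]"]) simp
  next
    case False
    then obtain x where "u = blk x" "in_syl x" "\<not> is_one x" "isl x \<noteq> s"
      using assms(1) unfolding blocks_def by blast
    then show ?thesis by (intro exI[of _ "[x]"]) (simp add: reduced_Cons)
  qed
  then show ?case unfolding codes_off_def by simp
next
  case (snoc w ws)
  then have "u @ concat ws \<in> codes_off s" by simp
  then obtain xs where xs: "u @ concat ws = code xs" "reduced xs" "xs = [] \<or> isl (last xs) \<noteq> s"
    unfolding codes_off_def by blast
  have "w \<in> lconc (blocks s) (blocks (\<not> s))" using snoc.prems by simp
  then obtain x y where xy: "w = blk x @ blk y" "in_syl x" "\<not> is_one x" "isl x = s"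
    "in_syl y" "\<not> is_one y" "isl y = (\<not> s)"
    unfolding lconc_def blocks_def by blast
  have "u @ concat (ws @ [w]) = code (xs @ [x, y])" using xs(1) xy(1) by simp
  moreover have "reduced (xs @ [x, y])" using xs xy by (simp add: reduced_append reduced_Cons)
  moreover have "isl (last (xs @ [x, y])) \<noteq> s" using xy by simp
  ultimately show ?case unfolding codes_off_def by blast
qed

lemma codes_off_eq:
  "codes_off s = lconc (insert [] (blocks (\<not> s))) (lstar (lconc (blocks s) (blocks (\<not> s))))"
proof
  show "codes_off s \<subseteq> lconc (insert [] (blocks (\<not> s))) (lstar (lconc (blocks s) (blocks (\<not> s))))"
    unfolding codes_off_def using code_in_lconc_lstar by blast
  show "lconc (insert [] (blocks (\<not> s))) (lstar (lconc (blocks s) (blocks (\<not> s)))) \<subseteq> codes_off s"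
  proof
    fix w assume "w \<in> lconc (insert [] (blocks (\<not> s))) (lstar (lconc (blocks s) (blocks (\<not> s))))"
    then obtain u ws where "u \<in> insert [] (blocks (\<not> s))" "ws \<in> lists (lconc (blocks s) (blocks (\<not> s)))"
      "w = u @ concat ws"
      unfolding lconc_def[of "insert _ _"] lstar_def by blast
    then show "w \<in> codes_off s" using lconc_lstar_in_codes_off by blast
  qed
qed

lemma fin_deriv_codes_off: "fin_deriv (codes_off s)"
proof -
  have "insert [] (blocks (\<not> s)) = {[]} \<union> blocks (\<not> s)" by blast
  then show ?thesis
    unfolding codes_off_eq
    by (simp only: fin_deriv_lconc fin_deriv_lstar fin_deriv_side_blocks fin_deriv_Un fin_deriv_finite finite.intros)
qed

lemma codes_eq: "code ` {xs. reduced xs} = codes_off True \<union> codes_off False"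
  unfolding codes_off_def by blast

lemma regular_codes: "regular_lang (sym_gens P gens) (code ` {xs. reduced xs})"
proof (rule fin_deriv_imp_regular_lang)
  show "finite (sym_gens P gens)"
    by (intro finite_sym_gens) (simp add: gens_def M1.finite_gens M2.finite_gens)
  show "code ` {xs. reduced xs} \<subseteq> lists (sym_gens P gens)" using code_in_lists by blast
  show "fin_deriv (code ` {xs. reduced xs})"
    unfolding codes_eq by (intro fin_deriv_Un fin_deriv_codes_off)
qed

lemma mult_rel_codes:
  assumes z: "in_syl z"
  shows "{(u, v). u \<in> code ` {xs. reduced xs} \<and> v \<in> code ` {xs. reduced xs} \<and>
      decode v = decode u \<otimes>\<^bsub>P\<^esub> emb z}
    = {(w @ blk x, w @ blk (smul x z)) | w x. w \<in> codes_off (isl z) \<and> in_syl x \<and> isl x = isl z}"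
    (is "?l = ?r")
proof
  show "?l \<subseteq> ?r"
  proof clarify
    fix xs ys assume *: "reduced xs" "reduced ys" "decode (code ys) = decode (code xs) \<otimes>\<^bsub>P\<^esub> emb z"
    obtain x vs where x: "in_syl x" "isl x = isl z" "xs = vs @ emb x" "reduced vs"
      "vs = [] \<or> isl (last vs) \<noteq> isl z"
      by (rule split_emb_right[OF *(1)])
    have "ys = vs @ emb (smul x z)"
      using *(3) append_emb_mult[of x z vs] x z
      unfolding decode_code[OF *(1)] decode_code[OF *(2)] by simp
    moreover have "code vs \<in> codes_off (isl z)" using x unfolding codes_off_def by blast
    ultimately show "\<exists>w xa. (code xs, code ys) = (w @ blk xa, w @ blk (smul xa z)) \<and>
        w \<in> codes_off (isl z) \<and> in_syl xa \<and> isl xa = isl z"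
      using x by (intro exI[of _ "code vs"] exI[of _ x]) (simp add: code_emb)
  qed
  show "?r \<subseteq> ?l"
  proof clarify
    fix w x assume x: "w \<in> codes_off (isl z)" "in_syl x" "isl x = isl z"
    then obtain vs where vs: "w = code vs" "reduced vs" "vs = [] \<or> isl (last vs) \<noteq> isl z"
      unfolding codes_off_def by blast
    have r: "reduced (vs @ emb x)" "reduced (vs @ emb (smul x z))"
      using vs x z by (auto intro!: reduced_append_emb in_syl_smul)
    have c: "w @ blk x = code (vs @ emb x)" "w @ blk (smul x z) = code (vs @ emb (smul x z))"
      by (simp_all add: vs(1) code_emb)
    have "decode (w @ blk (smul x z)) = decode (w @ blk x) \<otimes>\<^bsub>P\<^esub> emb z"
      unfolding c decode_code[OF r(1)] decode_code[OF r(2)]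
      using vs x z append_emb_mult[of x z vs] by simp
    then show "w @ blk x \<in> code ` {xs. reduced xs} \<and> w @ blk (smul x z) \<in> code ` {xs. reduced xs} \<and>
      decode (w @ blk (smul x z)) = decode (w @ blk x) \<otimes>\<^bsub>P\<^esub> emb z"
      using r c by blast
  qed
qed

lemma fin_deriv_mult_blk:
  assumes "(\<exists>g\<in>A1. z = Inl g) \<or> (\<exists>h\<in>A2. z = Inr h)"
  shows "fin_deriv {conv (blk x) (blk (smul x z)) | x. in_syl x \<and> isl x = isl z}"
  using assms
proof
  assume "\<exists>g\<in>A1. z = Inl g"
  then obtain g where g: "g \<in> A1" "z = Inl g" by blast
  have "{conv (blk x) (blk (smul x z)) | x. in_syl x \<and> isl x = isl z}
      = {conv (map embl (M1.mnf k)) (map embl (M1.mnf (k \<otimes>\<^bsub>G\<^esub> g))) | k. k \<in> carrier G}" (is "?l = ?r")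
  proof
    show "?l \<subseteq> ?r"
    proof clarify
      fix x assume "in_syl x" "isl x = isl z"
      then show "\<exists>k. conv (blk x) (blk (smul x z)) = conv (map embl (M1.mnf k)) (map embl (M1.mnf (k \<otimes>\<^bsub>G\<^esub> g))) \<and> k \<in> carrier G"
        by (cases x) (auto simp: g(2) blk_def syl_defs)
    qed
    show "?r \<subseteq> ?l"
    proof clarify
      fix k assume "k \<in> carrier G"
      then show "\<exists>x. conv (map embl (M1.mnf k)) (map embl (M1.mnf (k \<otimes>\<^bsub>G\<^esub> g))) = conv (blk x) (blk (smul x z)) \<and>
          in_syl x \<and> isl x = isl z"
        by (intro exI[of _ "Inl k"]) (simp add: g(2) blk_def syl_defs)
    qed
  qed
  then show ?thesis using M1.fin_deriv_mult_mnf[OF g(1)] by simp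
next
  assume "\<exists>h\<in>A2. z = Inr h"
  then obtain h where h: "h \<in> A2" "z = Inr h" by blast
  have "{conv (blk x) (blk (smul x z)) | x. in_syl x \<and> isl x = isl z}
      = {conv (map embr (M2.mnf k)) (map embr (M2.mnf (k \<otimes>\<^bsub>H\<^esub> h))) | k. k \<in> carrier H}" (is "?l = ?r")
  proof
    show "?l \<subseteq> ?r"
    proof clarify
      fix x assume "in_syl x" "isl x = isl z"
      then show "\<exists>k. conv (blk x) (blk (smul x z)) = conv (map embr (M2.mnf k)) (map embr (M2.mnf (k \<otimes>\<^bsub>H\<^esub> h))) \<and> k \<in> carrier H"
        by (cases x) (auto simp: h(2) blk_def syl_defs)
    qed
    show "?r \<subseteq> ?l"
    proof clarify
      fix k assume "k \<in> carrier H"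
      then show "\<exists>x. conv (map embr (M2.mnf k)) (map embr (M2.mnf (k \<otimes>\<^bsub>H\<^esub> h))) = conv (blk x) (blk (smul x z)) \<and>
          in_syl x \<and> isl x = isl z"
        by (intro exI[of _ "Inr k"]) (simp add: h(2) blk_def syl_defs)
    qed
  qed
  then show ?thesis using M2.fin_deriv_mult_mnf[OF h(1)] by simp
qed

lemma fa_recognizable_mult:
  assumes z: "(\<exists>g\<in>A1. z = Inl g) \<or> (\<exists>h\<in>A2. z = Inr h)"
  shows "fa_recognizable (sym_gens P gens) {(u, v). u \<in> code ` {xs. reduced xs} \<and>
      v \<in> code ` {xs. reduced xs} \<and> decode v = decode u \<otimes>\<^bsub>P\<^esub> emb z}" (is "fa_recognizable _ ?R")
proof (rule fa_recognizableI)
  show "finite (sym_gens P gens)"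
    by (intro finite_sym_gens) (simp add: gens_def M1.finite_gens M2.finite_gens)
  show "?R \<subseteq> lists (sym_gens P gens) \<times> lists (sym_gens P gens)" using code_in_lists by blast
  have syl: "in_syl z" using z M1.gens_subset M2.gens_subset by (auto simp: in_syl_def)
  let ?T = "{conv (blk x) (blk (smul x z)) | x. in_syl x \<and> isl x = isl z}"
  have "(\<lambda>(u, v). conv u v) ` {(f w x, g w x) | w x. Q w x} = {conv (f w x) (g w x) | w x. Q w x}"
    for f g :: "('a + 'b) list list \<Rightarrow> 'a + 'b \<Rightarrow> ('a + 'b) list list" and Q
    by (force simp: image_iff)
  then have "(\<lambda>(u, v). conv u v) ` ?R
      = {conv (w @ blk x) (w @ blk (smul x z)) | w x. w \<in> codes_off (isl z) \<and> in_syl x \<and> isl x = isl z}"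
    unfolding mult_rel_codes[OF syl] .
  \<comment> \<open>A common prefix gives unpadded diagonal letters, and \<open>w\<close> varies
    independently of \<open>x\<close>. Hence the convolutions form a full product of two
    languages.\<close>
  also have "\<dots> = lconc (map (\<lambda>s. (Some s, Some s)) ` codes_off (isl z)) ?T"
    unfolding conv_append conv_diag lconc_def by blast
  finally have "(\<lambda>(u, v). conv u v) ` ?R = lconc (map (\<lambda>s. (Some s, Some s)) ` codes_off (isl z)) ?T" .
  then show "fin_deriv ((\<lambda>(u, v). conv u v) ` ?R)"
    by (simp only: fin_deriv_lconc fin_deriv_map fin_deriv_codes_off fin_deriv_mult_blk[OF z])
qed

lemma cayley_aut_rep_free_product: "cayley_aut_rep P gens (code ` {xs. reduced xs}) decode"
  unfolding cayley_aut_rep_def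
proof (intro conjI ballI)
  fix a assume "a \<in> gens"
  then obtain z where "a = emb z" "(\<exists>g\<in>A1. z = Inl g) \<or> (\<exists>h\<in>A2. z = Inr h)"
    unfolding gens_def by blast
  then show "fa_recognizable (sym_gens P gens) {(u, v). u \<in> code ` {xs. reduced xs} \<and>
      v \<in> code ` {xs. reduced xs} \<and> decode v = decode u \<otimes>\<^bsub>P\<^esub> a}"
    using fa_recognizable_mult by simp
next
  show "code ` {xs. reduced xs} \<subseteq> lists (sym_gens P gens)" using code_in_lists by blast
qed (rule regular_codes bij_decode)+

end

section \<open>Bounding the distance\<close>

text \<open>Entries are added one at a time; partial sums stay above \<open>n0\<close>, so
  superadditivity keeps applying. The empty list is excluded because \<open>f 0\<close> may be
  negative.\<close>

lemma sum_list_le_superadditive: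
  fixes f :: "nat \<Rightarrow> real"
  assumes "\<And>x y. n0 \<le> x \<Longrightarrow> n0 \<le> y \<Longrightarrow> f x + f y \<le> f (x + y)"
    and "ns \<noteq> []" "\<And>n. n \<in> set ns \<Longrightarrow> n0 \<le> n"
  shows "(\<Sum>n\<leftarrow>ns. f n) \<le> f (sum_list ns)"
  using assms(2,3)
proof (induction ns rule: list_nonempty_induct)
  case (cons n ns)
  have "n0 \<le> sum_list ns"
  proof -
    obtain m where "m \<in> set ns" using cons.hyps by (cases ns) auto
    then have "n0 \<le> m" "m \<le> sum_list ns" using cons.prems member_le_sum_list by auto
    then show ?thesis by linarith
  qed
  then have "f n + f (sum_list ns) \<le> f (n + sum_list ns)" using assms(1) cons.prems by simp
  moreover have "(\<Sum>n\<leftarrow>ns. f n) \<le> f (sum_list ns)" using cons by simp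
  ultimately show ?case by simp
qed simp

text \<open>Superadditivity for \<open>n\<close> copies of \<open>x0\<close> bounds \<open>n\<close>
  times \<open>f x0\<close> by the value at \<open>n * x0\<close>, and monotonicity passes to
  \<open>M * n\<close>. The constant is \<open>1 / f x0\<close> rounded up.\<close>

lemma linear_le_superadditive:
  fixes f :: "nat \<Rightarrow> real"
  assumes f: "\<And>x y. n0 \<le> x \<Longrightarrow> n0 \<le> y \<Longrightarrow> f x + f y \<le> f (x + y)"
    and mono: "\<And>n m. Q \<le> n \<Longrightarrow> n \<le> m \<Longrightarrow> 0 \<le> f n \<and> f n \<le> f m"
    and x0: "n0 \<le> x0" "Q \<le> x0" "0 < f x0"
  shows "\<exists>K::nat. \<forall>M\<ge>x0. \<forall>n>0. real n \<le> real K * f (M * n)"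
proof (intro exI allI impI)
  fix M n :: nat assume M: "x0 \<le> M" and n: "0 < n"
  define K where "K = nat \<lceil>1 / f x0\<rceil>"
  have K: "1 \<le> real K * f x0"
  proof -
    have "1 / f x0 \<le> real K" unfolding K_def by linarith
    then show ?thesis using x0(3) by (simp add: pos_divide_le_eq)
  qed
  have "(\<Sum>k\<leftarrow>replicate n x0. f k) \<le> f (sum_list (replicate n x0))"
    by (rule sum_list_le_superadditive[OF f]) (use x0 n in auto)
  then have 1: "real n * f x0 \<le> f (n * x0)" by (simp add: sum_list_replicate)
  have "x0 \<le> n * x0" "n * x0 \<le> M * n" using M n by (simp_all add: mult.commute)
  then have "f (n * x0) \<le> f (M * n)" using mono[of "n * x0" "M * n"] x0(2) by linarith
  with 1 have 2: "real n * f x0 \<le> f (M * n)" by linarith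
  have "real n * 1 \<le> real n * (real K * f x0)" using K by (intro mult_left_mono) auto
  also have "\<dots> = real K * (real n * f x0)" by simp
  also have "\<dots> \<le> real K * f (M * n)" using 2 by (intro mult_left_mono) auto
  finally show "real n \<le> real (nat \<lceil>1 / f x0\<rceil>) * f (M * n)" by (simp add: K_def)
qed

context free_rep
begin

section \<open>Word lengths and evaluation in the free product\<close>

lemma eval_map_emb:
  "w \<in> lists (sym_gens G A1) \<Longrightarrow> eval_word P (map embl w) = embl (eval_word G w)"
  "v \<in> lists (sym_gens H A2) \<Longrightarrow> eval_word P (map embr v) = embr (eval_word H v)"
proof -
  interpret l: group_hom G P embl by (rule hom_Inl)
  interpret r: group_hom H P embr by (rule hom_Inr)
  show "w \<in> lists (sym_gens G A1) \<Longrightarrow> eval_word P (map embl w) = embl (eval_word G w)"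
    using l.eval_word_map lists_mono[OF M1.sym_gens_subset] by blast
  show "v \<in> lists (sym_gens H A2) \<Longrightarrow> eval_word P (map embr v) = embr (eval_word H v)"
    using r.eval_word_map lists_mono[OF M2.sym_gens_subset] by blast
qed

text \<open>A shortest word in the factor maps letter by letter to a word of the same
  length.\<close>

lemma word_len_emb:
  "g \<in> carrier G \<Longrightarrow> word_len P gens (embl g) \<le> word_len G A1 g"
  "h \<in> carrier H \<Longrightarrow> word_len P gens (embr h) \<le> word_len H A2 h"
proof -
  assume "g \<in> carrier G"
  then obtain w where "w \<in> lists (sym_gens G A1)" "length w = word_len G A1 g" "eval_word G w = g"
    by (rule M1.word_len_attained)
  then show "word_len P gens (embl g) \<le> word_len G A1 g"
    using word_len_le[OF map_emb_in_lists(1)] eval_map_emb(1) by (metis length_map)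
next
  assume "h \<in> carrier H"
  then obtain w where "w \<in> lists (sym_gens H A2)" "length w = word_len H A2 h" "eval_word H w = h"
    by (rule M2.word_len_attained)
  then show "word_len P gens (embr h) \<le> word_len H A2 h"
    using word_len_le[OF map_emb_in_lists(2)] eval_map_emb(2) by (metis length_map)
qed

lemma reduced_Cons_mult: "reduced (x # xs) \<Longrightarrow> x # xs = emb x \<otimes>\<^bsub>P\<^esub> xs"
  using push_Cons[of x xs] by (simp add: mult_P emb_def reduced_Cons)

lemma word_len_reduced:
  "reduced xs \<Longrightarrow> word_len P gens xs \<le> (\<Sum>x\<leftarrow>xs. word_len P gens (emb x))"
proof (induction xs)
  case Nil
  then show ?case using gen_group.word_len_one[OF gen_group_P] by (simp add: one_P)
next
  case (Cons x xs)
  then have "emb x \<in> carrier P" "xs \<in> carrier P"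
    by (auto simp: carrier_P reduced_Cons reduced_emb)
  then have "word_len P gens (x # xs) \<le> word_len P gens (emb x) + word_len P gens xs"
    unfolding reduced_Cons_mult[OF Cons.prems] by (rule gen_group.word_len_mult[OF gen_group_P])
  then show ?case using Cons by (simp add: reduced_Cons)
qed

lemma eval_code:
  assumes "\<And>g. g \<in> carrier G \<Longrightarrow> eval_word G (M1.nf g) = g"
    and "\<And>h. h \<in> carrier H \<Longrightarrow> eval_word H (M2.nf h) = h"
  shows "reduced xs \<Longrightarrow> eval_word P (code xs) = xs"
proof (induction xs)
  case Nil
  show ?case by (simp add: eval_word_def one_P)
next
  case (Cons x xs)
  then have x: "in_syl x" "\<not> is_one x" "reduced xs" by (auto simp: reduced_Cons)
  have "eval_word P (blk x) = emb x"
  proof (cases x)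
    case (Inl g)
    then have "g \<in> carrier G" "g \<noteq> \<one>\<^bsub>G\<^esub>" using x by (auto simp: syl_defs)
    then show ?thesis
      using assms(1) by (simp add: Inl blk_def eval_map_emb M1.mnf_in_lists M1.eval_mnf)
  next
    case (Inr h)
    then have "h \<in> carrier H" "h \<noteq> \<one>\<^bsub>H\<^esub>" using x by (auto simp: syl_defs)
    then show ?thesis
      using assms(2) by (simp add: Inr blk_def eval_map_emb M2.mnf_in_lists M2.eval_mnf)
  qed
  moreover have "eval_word P (code (x # xs)) = eval_word P (blk x) \<otimes>\<^bsub>P\<^esub> eval_word P (code xs)"
    unfolding code_simps
    by (rule gen_group.eval_word_append[OF gen_group_P blk_in_lists[OF x(1)] code_in_lists[OF x(3)]])
  ultimately show ?case
    using Cons.IH[OF x(3)] reduced_Cons_mult[OF Cons.prems] by simp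
qed

text \<open>Compares both elements with the identity rather than with each other. The loss is linear
  in the length of the code, which is harmless once \<open>f\<close> grows at least
  linearly.\<close>

lemma word_metric_code_le:
  assumes xs: "reduced xs"
  shows "word_metric P gens (eval_word P (code xs)) xs
    \<le> length (code xs) + (\<Sum>x\<leftarrow>xs. word_len P gens (emb x))"
proof -
  interpret GP: gen_group P gens by (rule gen_group_P)
  have w: "code xs \<in> lists (sym_gens P gens)" by (rule code_in_lists[OF xs])
  have "eval_word P (code xs) \<in> carrier P" by (rule GP.eval_word_closed[OF w])
  moreover have "xs \<in> carrier P" using xs by (simp add: carrier_P)
  ultimately have "word_metric P gens (eval_word P (code xs)) xs
      \<le> word_len P gens (inv\<^bsub>P\<^esub> eval_word P (code xs)) + word_len P gens xs"
    unfolding word_metric_eq_word_len by (intro GP.word_len_mult GP.inv_closed)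
  then show ?thesis
    using GP.word_len_inv_eval[OF w] word_len_reduced[OF xs] by linarith
qed

lemma length_blk: "in_syl x \<Longrightarrow> \<not> is_one x \<Longrightarrow> length (blk x) > 0"
  using hd_blk(1) by blast

lemma sum_length_blk: "(\<Sum>x\<leftarrow>xs. length (blk x)) = length (code xs)"
  by (induction xs) auto

lemma sum_word_len_le:
  fixes f :: "nat \<Rightarrow> real"
  assumes f: "\<And>x y. n0 \<le> x \<Longrightarrow> n0 \<le> y \<Longrightarrow> f x + f y \<le> f (x + y)"
    and len: "\<And>x. in_syl x \<Longrightarrow> \<not> is_one x \<Longrightarrow> real (word_len P gens (emb x)) \<le> real K * f (M * length (blk x))"
    and M: "n0 \<le> M" and xs: "reduced xs" "xs \<noteq> []"
  shows "real (\<Sum>x\<leftarrow>xs. word_len P gens (emb x)) \<le> real K * f (M * length (code xs))"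
proof -
  have "real (\<Sum>x\<leftarrow>xs. word_len P gens (emb x)) = (\<Sum>x\<leftarrow>xs. real (word_len P gens (emb x)))"
    by (induction xs) auto
  also have "\<dots> \<le> (\<Sum>x\<leftarrow>xs. real K * f (M * length (blk x)))"
    using reduced_in_syl[OF xs(1)] len by (intro sum_list_mono) blast
  also have "\<dots> = real K * (\<Sum>n\<leftarrow>map (\<lambda>x. M * length (blk x)) xs. f n)"
    by (induction xs) (auto simp: algebra_simps)
  also have "(\<Sum>n\<leftarrow>map (\<lambda>x. M * length (blk x)) xs. f n) \<le> f (sum_list (map (\<lambda>x. M * length (blk x)) xs))"
  proof (rule sum_list_le_superadditive[OF f])
    fix n assume "n \<in> set (map (\<lambda>x. M * length (blk x)) xs)"
    then obtain x where x: "x \<in> set xs" "n = M * length (blk x)" by auto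
    then have "0 < length (blk x)" using reduced_in_syl[OF xs(1)] length_blk by blast
    \<comment> \<open>Nonempty blocks and \<open>n0 \<le> M\<close> keep every argument of
      \<open>f\<close> in the range where superadditivity holds.\<close>
    then have "M * 1 \<le> n" unfolding x(2) by (intro mult_le_mono2) linarith
    then show "n0 \<le> n" using M by linarith
  qed (use xs in auto)
  also have "sum_list (map (\<lambda>x. M * length (blk x)) xs) = M * length (code xs)"
    by (simp add: sum_list_const_mult sum_length_blk)
  finally show ?thesis by (simp add: mult_left_mono)
qed

lemma fun_preceq_free_product:
  fixes f :: "nat \<Rightarrow> real"
  assumes f: "\<And>x y. n0 \<le> x \<Longrightarrow> n0 \<le> y \<Longrightarrow> f x + f y \<le> f (x + y)"
    and mono: "\<And>n m. Q \<le> n \<Longrightarrow> n \<le> m \<Longrightarrow> 0 \<le> f n \<and> f n \<le> f m"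
    and h1: "fun_preceq (rep_fun G A1 L1 \<psi>1) f" and h2: "fun_preceq (rep_fun H A2 L2 \<psi>2) f"
  shows "fun_preceq (rep_fun P gens (code ` {xs. reduced xs}) decode) f"
\<comment> \<open>Either \<open>f\<close> is positive somewhere past both thresholds, which gives
  linear growth, or it vanishes from there on.\<close>
proof (cases "\<exists>x0. n0 \<le> x0 \<and> Q \<le> x0 \<and> 0 < f x0")
  case True
  then obtain x0 where x0: "n0 \<le> x0" "Q \<le> x0" "0 < f x0" by blast
  obtain K where K: "\<And>M n. x0 \<le> M \<Longrightarrow> 0 < n \<Longrightarrow> real n \<le> real K * f (M * n)"
    using linear_le_superadditive[OF f mono x0] by blast
  obtain K1 M1' where K1: "\<And>K M g. K1 \<le> K \<Longrightarrow> M1' \<le> M \<Longrightarrow> g \<in> carrier G \<Longrightarrow> g \<noteq> \<one>\<^bsub>G\<^esub> \<Longrightarrow>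
      real (word_metric G A1 (eval_word G (M1.nf g)) g) \<le> real K * f (M * length (M1.mnf g))"
    using M1.metric_le_f_mnf[OF h1 mono] by blast
  obtain K2 M2' where K2: "\<And>K M g. K2 \<le> K \<Longrightarrow> M2' \<le> M \<Longrightarrow> g \<in> carrier H \<Longrightarrow> g \<noteq> \<one>\<^bsub>H\<^esub> \<Longrightarrow>
      real (word_metric H A2 (eval_word H (M2.nf g)) g) \<le> real K * f (M * length (M2.mnf g))"
    using M2.metric_le_f_mnf[OF h2 mono] by blast
  \<comment> \<open>One multiplier above the thresholds for linear growth and for both factors;
    \<open>Suc\<close> makes it positive.\<close>
  define M where "M = Suc (x0 + M1' + M2')"
  define K' where "K' = K1 + K2"
  have M: "x0 \<le> M" "M1' \<le> M" "M2' \<le> M" "0 < M" by (simp_all add: M_def)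
  \<comment> \<open>The length of a syllable is at most its block length plus the distance from the
    evaluated representative. The constant \<open>K\<close> pays for the first summand,
    \<open>K'\<close> for the second.\<close>
  have len: "real (word_len P gens (emb x)) \<le> real (K + K') * f (M * length (blk x))"
    if x: "in_syl x" "\<not> is_one x" for x
  proof -
    have lin: "real (length (blk x)) \<le> real K * f (M * length (blk x))"
      using K[OF M(1) length_blk[OF x]] .
    show ?thesis
    proof (cases x)
      case (Inl g)
      then have g: "g \<in> carrier G" "g \<noteq> \<one>\<^bsub>G\<^esub>" using x by (auto simp: syl_defs)
      have b: "length (blk x) = length (M1.mnf g)" by (simp add: blk_def Inl)
      have "real (word_metric G A1 (eval_word G (M1.nf g)) g) \<le> real K' * f (M * length (M1.mnf g))"
        by (rule K1[OF _ M(2) g]) (simp add: K'_def)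
      then show ?thesis
        using word_len_emb(1)[OF g(1)] M1.word_len_le_mnf[OF g] lin
        unfolding Inl[symmetric] b by (simp add: Inl distrib_right)
    next
      case (Inr h)
      then have g: "h \<in> carrier H" "h \<noteq> \<one>\<^bsub>H\<^esub>" using x by (auto simp: syl_defs)
      have b: "length (blk x) = length (M2.mnf h)" by (simp add: blk_def Inr)
      have "real (word_metric H A2 (eval_word H (M2.nf h)) h) \<le> real K' * f (M * length (M2.mnf h))"
        by (rule K2[OF _ M(3) g]) (simp add: K'_def)
      then show ?thesis
        using word_len_emb(2)[OF g(1)] M2.word_len_le_mnf[OF g] lin
        unfolding Inr[symmetric] b by (simp add: Inr distrib_right)
    qed
  qed
  \<comment> \<open>\<open>K\<close> accounts for the code length and \<open>K + K'\<close> for the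
    syllables; \<open>Suc\<close> provides the positivity required by
    \<open>fun_preceq\<close>.\<close>
  define C where "C = Suc (K + (K + K'))"
  have bound: "real (word_metric P gens (eval_word P u) (decode u)) \<le> real C * f (M * n)"
    if u: "u \<in> code ` {xs. reduced xs}" "length u \<le> n" and n: "1 \<le> n" for u n
  proof -
    obtain xs where xs: "u = code xs" "reduced xs" using u(1) by blast
    have "x0 \<le> M * n" using M(1) n by (metis le_trans mult.right_neutral mult_le_mono2)
    then have nonneg: "0 \<le> f (M * n)" using mono[of "M * n" "M * n"] x0(2) by linarith
    show ?thesis
    \<comment> \<open>The empty word is treated apart, since the summed bound needs at least one
      block. Its distance is zero.\<close>
    proof (cases "xs = []")
      case True
      have "[] \<in> carrier P" by (simp add: carrier_P)
      then have "word_metric P gens (eval_word P u) (decode u) = 0"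
        using gen_group.word_metric_self[OF gen_group_P] decode_code[OF xs(2)]
        by (simp add: xs(1) True eval_word_def one_P)
      then show ?thesis using nonneg by simp
    next
      case False
      have pos: "0 < length u" using hd_code(1)[OF xs(2) False] by (simp add: xs(1))
      have "real (word_metric P gens (eval_word P u) (decode u))
          \<le> real (length u) + real (\<Sum>x\<leftarrow>xs. word_len P gens (emb x))"
        using word_metric_code_le[OF xs(2)] decode_code[OF xs(2)] by (simp add: xs(1))
      also have "\<dots> \<le> real K * f (M * length u) + real (K + K') * f (M * length u)"
        using K[OF M(1) pos] sum_word_len_le[OF f len _ xs(2) False] x0(1) M(1)
        by (simp add: xs(1) add_mono)
      also have "\<dots> = real (K + (K + K')) * f (M * length u)" by (simp add: distrib_right)
      also have "\<dots> \<le> real C * f (M * n)"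
      proof -
        have "x0 \<le> M * length u" using M(1) pos by (metis One_nat_def Suc_leI le_trans mult.right_neutral mult_le_mono2)
        then have "0 \<le> f (M * length u) \<and> f (M * length u) \<le> f (M * n)"
          using x0(2) u(2) by (intro mono) auto
        then show ?thesis by (intro mult_mono) (auto simp: C_def)
      qed
      finally show ?thesis .
    qed
  qed
  have "rep_fun P gens (code ` {xs. reduced xs}) decode n \<le> real C * f (M * n)" if n: "1 \<le> n" for n
  proof (rule rep_fun_le)
    show "finite gens" by (simp add: gens_def M1.finite_gens M2.finite_gens)
    show "code ` {xs. reduced xs} \<subseteq> lists (sym_gens P gens)" using code_in_lists by blast
    have "x0 \<le> M * n" using M(1) n by (metis le_trans mult.right_neutral mult_le_mono2)
    then show "0 \<le> real C * f (M * n)" using mono[of "M * n" "M * n"] x0(2) by simp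
  qed (rule bound[OF _ _ n])
  moreover have "C > 0" by (simp add: C_def)
  ultimately show ?thesis using M(4) unfolding fun_preceq_def by blast
next
  case False
  \<comment> \<open>Past the thresholds \<open>f\<close> is nonnegative and, by the case assumption,
    not positive.\<close>
  have f0: "f n = 0" if "max n0 Q \<le> n" for n
    using False mono[of n n] that by (metis le_refl less_eq_real_def max.boundedE)
  have ev: "eval_word P (code xs) = xs" if "reduced xs" for xs
    using M1.eval_nf_if_f_eventually_0[OF h1 f0] M2.eval_nf_if_f_eventually_0[OF h2 f0] that
    by (rule eval_code)
  have "rep_fun P gens (code ` {xs. reduced xs}) decode n \<le> 0" for n
  proof (rule rep_fun_le)
    show "finite gens" by (simp add: gens_def M1.finite_gens M2.finite_gens)
    show "code ` {xs. reduced xs} \<subseteq> lists (sym_gens P gens)" using code_in_lists by blast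
    fix u assume "u \<in> code ` {xs. reduced xs}"
    then obtain xs where "u = code xs" "reduced xs" by blast
    then show "real (word_metric P gens (eval_word P u) (decode u)) \<le> 0"
      using gen_group.word_metric_self[OF gen_group_P, of xs] by (simp add: ev decode_code carrier_P)
  qed simp
  moreover have "f (1 * n) = 0" if "max n0 Q \<le> n" for n using f0[OF that] by simp
  ultimately have "\<forall>n\<ge>max n0 Q. rep_fun P gens (code ` {xs. reduced xs}) decode n \<le> real 1 * f (1 * n)"
    by simp
  then show ?thesis unfolding fun_preceq_def using zero_less_one by blast
qed

end

section \<open>Closure of the class under free products\<close>

theorem mainTheorem6:
  fixes f :: "nat \<Rightarrow> real"
    and G1 :: "('a, 'm) monoid_scheme" and G2 :: "('b, 'n) monoid_scheme"
  assumes "in_frakF f"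
    and "\<exists>n0. \<forall>x y. n0 \<le> x \<longrightarrow> n0 \<le> y \<longrightarrow> f x + f y \<le> f (x + y)"
    and "group G1" and "group G2"
    and "in_B f G1" and "in_B f G2"
  shows "in_B f (free_product G1 G2)"
proof -
  obtain Q where mono: "\<And>n m. Q \<le> n \<Longrightarrow> n \<le> m \<Longrightarrow> 0 \<le> f n \<and> f n \<le> f m"
    using assms(1) unfolding in_frakF_def by blast
  obtain n0 where f: "\<And>x y. n0 \<le> x \<Longrightarrow> n0 \<le> y \<Longrightarrow> f x + f y \<le> f (x + y)"
    using assms(2) by blast
  obtain A1 L1 \<psi>1 where 1: "finite A1" "A1 \<subseteq> carrier G1" "generate G1 A1 = carrier G1"
    "cayley_aut_rep G1 A1 L1 \<psi>1" and h1: "fun_preceq (rep_fun G1 A1 L1 \<psi>1) f"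
    using assms(5) unfolding in_B_def by blast
  obtain A2 L2 \<psi>2 where 2: "finite A2" "A2 \<subseteq> carrier G2" "generate G2 A2 = carrier G2"
    "cayley_aut_rep G2 A2 L2 \<psi>2" and h2: "fun_preceq (rep_fun G2 A2 L2 \<psi>2) f"
    using assms(6) unfolding in_B_def by blast
  have "cayley_rep G1 A1 L1 \<psi>1"
    using assms(3) 1 unfolding cayley_rep_def cayley_rep_axioms_def gen_group_def gen_group_axioms_def by blast
  then obtain a1 where a1: "marked_rep G1 A1 L1 \<psi>1 a1" using cayley_rep.marker_exists by blast
  have "cayley_rep G2 A2 L2 \<psi>2"
    using assms(4) 2 unfolding cayley_rep_def cayley_rep_axioms_def gen_group_def gen_group_axioms_def by blast
  then obtain a2 where a2: "marked_rep G2 A2 L2 \<psi>2 a2" using cayley_rep.marker_exists by blast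
  interpret free_rep G1 G2 A1 L1 \<psi>1 a1 A2 L2 \<psi>2 a2
    unfolding free_rep_def two_groups_def using assms(3,4) a1 a2 by blast
  have "finite gens" by (simp add: gens_def 1(1) 2(1))
  then show ?thesis
    unfolding in_B_def
    using gens_subset generate_gens cayley_aut_rep_free_product
      fun_preceq_free_product[OF f mono h1 h2] by blast
qed

end
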